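(* Let $\alpha\ge0$ and $\sigma\in\mathbb{R}$. Let the plant $\dot x_p=A_px_p+B_pu$, $y=C_px_p$ be given, with $x_p(t)\in\mathbb{R}^{n_p}$, $u(t)\in\mathbb{R}^{n_u}$, $y(t)\in\mathbb{R}^{n_y}$. Let $\Lambda_p=\tilde L_{\Delta_p}^\top\tilde L_{\Delta_p}\in\mathbb{R}^{n_u\times n_u}$ be given, with $\Lambda_p\succeq0$ diagonal and $\tilde L_{\Delta_p}\in\mathbb{R}^{n_u\times n_u}$. Write $\mathrm{He}(Y)=Y+Y^\top$ and abbreviate $L=\tilde L_{\Delta_p}$. Suppose there exist $$\hat\theta=\{S,R,N_A,N_B,N_C,D_{kuw},\hat D_{kvy},\hat D_{kvw},\Lambda_k\}$$ where $S,R\in\mathbb{R}^{n_p\times n_p}$ are symmetric, $N_A=\begin{bmatrix} N_{A11} & N_{A12} \\ N_{A21} & N_{A22} \end{bmatrix}\in\mathbb{R}^{(n_p+n_u)\times(n_p+n_y)}$ with $N_{A11}\in\mathbb{R}^{n_p\times n_p}$ and $N_{A22}\in\mathbb{R}^{n_u\times n_y}$, $N_B\in\mathbb{R}^{n_p\times n_\phi}$, $N_C\in\mathbb{R}^{n_\phi\times n_p}$, $D_{kuw}\in\mathbb{R}^{n_u\times n_\phi}$, $\hat D_{kvy}\in\mathbb{R}^{n_\phi\times n_y}$, $\hat D_{kvw}\in\mathbb{R}^{n_\phi\times n_\phi}$, $\Lambda_k\in\mathbb{R}^{n_\phi\times n_\phi}$, such that $S\succ0$, $R\succ0$, $\Lambda_k\succ0$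 with $\Lambda_k$ diagonal, $\begin{bmatrix} R & I \\ I & S \end{bmatrix}\succ0$, and the symmetric matrix $$\begin{bmatrix} \mathrm{He}(A_pR+B_pN_{A21}) & A_p+B_pN_{A22}C_p+N_{A11}^\top & B_p & B_pD_{kuw}+N_C^\top & \alpha N_{A21}^\top L^\top\\ N_{A11}+A_p^\top+C_p^\top N_{A22}^\top B_p^\top & \mathrm{He}(SA_p+N_{A12}C_p) & SB_p & N_B+C_p^\top\hat D_{kvy}^\top & \alpha C_p^\top N_{A22}^\top L^\top\\ B_p^\top & B_p^\top S & -\Lambda_p & 0 & \frac{\alpha(1+\sigma)}{2}L^\top\\ D_{kuw}^\top B_p^\top+N_C & N_B^\top+\hat D_{kvy}C_p & 0 & \hat D_{kvw}+\hat D_{kvw}^\top-2\Lambda_k & \alpha D_{kuw}^\top L^\top\\ \alpha LN_{A21} & \alpha LN_{A22}C_p & \frac{\alpha(1+\sigma)}{2}L & \alpha LD_{kuw} & -I \end{bmatrix}$$ is negative semidefinite. Then a neural network controller with parameters $\theta=(A_k,B_{kw},B_{ky},C_{kv},D_{kvw},D_{kvy},C_{ku},D_{kuw},D_{kuy})$ and order $n_k=n_p$ can be reconstructed from $\hat\theta$ (by solving the reconstruction equations given in the context) such that this controller satisfies the disk margin $D(\alpha,\sigma)$.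
   Context: All matrices are real. $\mathcal{L}_{2e}^n$ is the space of functions $\mathbb{R}_{\ge0}\to\mathbb{R}^n$ that are square-integrable on $[0,T]$ for every $T>0$. Controller: a neural network controller with parameters $\theta$ is $$\begin{bmatrix}\dot x_k\\ v_k\\ \tilde u\end{bmatrix}=\begin{bmatrix}A_k & B_{kw} & B_{ky}\\ C_{kv} & D_{kvw} & D_{kvy}\\ C_{ku} & D_{kuw} & D_{kuy}\end{bmatrix}\begin{bmatrix}x_k\\ w_k\\ y\end{bmatrix},\qquad w_k(t)=\phi(v_k(t)),$$ with $x_k(t)\in\mathbb{R}^{n_k}$, $v_k(t),w_k(t)\in\mathbb{R}^{n_\phi}$. Here the controller order is assumed equal to the plant order, $n_k=n_p$. The activation $\phi:\mathbb{R}^{n_\phi}\to\mathbb{R}^{n_\phi}$ is given, memoryless and applied elementwise, $(\phi(v))_i=\phi_i(v_i)$, where each $\phi_i:\mathbb{R}\to\mathbb{R}$ is sector-bounded in $[0,1]$ (that is, $\phi_i(s)(s-\phi_i(s))\ge0$ for all $s$) and slope-restricted in $[0,1]$ (that is, $0\le\frac{\phi_i(a)-\phi_i(b)}{a-b}\le1$ for all $a\ne b$). Reconstruction equations: choose $U,V\in\mathbb{R}^{n_p\times n_p}$ with $VU^\top=I-RS$; the matrix $D_{kuw}$ is taken from $\hat\theta$, and the remaining parameters $A_k,B_{kw},B_{ky},C_{kv},D_{kvw},D_{kvy},C_{ku},D_{kuy}$ solve $$N_A=\begin{bmatrix} SA_pR & 0 \\ 0 & 0 \end{bmatrix}+\begin{bmatrix}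 U & SB_p \\ 0 & I \end{bmatrix}\begin{bmatrix} A_k & B_{ky} \\ C_{ku} & D_{kuy} \end{bmatrix}\begin{bmatrix} V^\top & 0 \\ C_pR & I \end{bmatrix},$$ $$N_B=SB_pD_{kuw}+UB_{kw},\quad N_C=\Lambda_kD_{kvy}C_pR+\Lambda_kC_{kv}V^\top,\quad \hat D_{kvy}=\Lambda_kD_{kvy},\quad \hat D_{kvw}=\Lambda_kD_{kvw}.$$ Uncertainty: $\Delta_p$ ranges over (possibly nonlinear, time-varying) causal operators $\mathcal{L}_{2e}^{n_u}\to\mathcal{L}_{2e}^{n_u}$ that are diagonal, i.e. $(\Delta_p(v))_i=\Delta_{p,i}(v_i)$ for each channel $i$, and have $\mathcal{L}_2$ gain less than $\alpha$, i.e. there is $0\le\gamma<\alpha$ with $\int_0^T\|\Delta_p(v)(t)\|^2dt\le\gamma^2\int_0^T\|v(t)\|^2dt$ for all $v\in\mathcal{L}_{2e}^{n_u}$ and $T\ge0$. Uncertain plant: for such a $\Delta_p$, the uncertain plant $\tilde P_{\Delta_p}$ with input $\tilde u$ and output $y$ is given by the plant equations $\dot x_p=A_px_p+B_pu$, $y=C_px_p$ together with $$u=v_p+\tfrac{1-\sigma}{2}w_p,\qquad v_p=\tilde u+\tfrac{1+\sigma}{2}w_p,\qquad w_p=\Delta_p(v_p).$$ Let $\mathcal{M}_\alpha$ be the set of all $\tilde P_{\Delta_p}$ where $\Delta_p$ is a causal, diagonal operator $\mathcal{L}_{2e}^{n_u}\to\mathcal{L}_{2e}^{n_u}$ with $\mathcal{L}_2$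 gain less than $\alpha$. Disk margin: the controller satisfies the disk margin $D(\alpha,\sigma)$ if it stabilizes every plant in $\mathcal{M}_\alpha$, i.e. for every $\tilde P_{\Delta_p}\in\mathcal{M}_\alpha$ the closed loop of $\tilde P_{\Delta_p}$ and the controller (obtained by connecting $y$ and $\tilde u$) is stable. Stability is Lyapunov stability of the origin in the closed-loop state $x=(x_p,x_k)$: for every $\varepsilon>0$ there is $\delta>0$ such that every closed-loop trajectory with $\|x(0)\|<\delta$ satisfies $\|x(t)\|<\varepsilon$ for all $t\ge0$. Here a closed-loop trajectory consists of an absolutely continuous $x=(x_p,x_k)$ and $v_p,v_k,w_p,w_k\in\mathcal{L}_{2e}$ satisfying, for almost every $t\ge0$, the plant equations $\dot x_p=A_px_p+B_pu$, $y=C_px_p$; the uncertainty equations $u=v_p+\tfrac{1-\sigma}{2}w_p$, $v_p=\tilde u+\tfrac{1+\sigma}{2}w_p$, $w_p=\Delta_p(v_p)$; and the controller equations $\dot x_k=A_kx_k+B_{kw}w_k+B_{ky}y$, $v_k=C_{kv}x_k+D_{kvw}w_k+D_{kvy}y$, $\tilde u=C_{ku}x_k+D_{kuw}w_k+D_{kuy}y$, $w_k=\phi(v_k)$. *)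

theory Defs
  imports "HOL-Analysis.Analysis"
begin

section \<open>Matrices\<close>

text \<open>Block matrices are indexed by sum types.\<close>

definition hcat :: "real^'a^'m \<Rightarrow> real^'b^'m \<Rightarrow> real^('a + 'b)^'m"  (infixr "|||" 61) where
  "M ||| N = (\<chi> i j. case j of Inl a \<Rightarrow> M $ i $ a | Inr b \<Rightarrow> N $ i $ b)"

definition vcat :: "real^'n^'a \<Rightarrow> real^'n^'b \<Rightarrow> real^'n^('a + 'b)"  (infixr "===" 60) where
  "M === N = (\<chi> i j. case i of Inl a \<Rightarrow> M $ a $ j | Inr b \<Rightarrow> N $ b $ j)"

definition He :: "real^'n^'n \<Rightarrow> real^'n^'n" where
  "He Y = Y + transpose Y"

definition symmetric_matrix :: "real^'n^'n \<Rightarrow> bool" where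
  "symmetric_matrix M \<longleftrightarrow> transpose M = M"

definition diagonal_matrix :: "real^'n^'n \<Rightarrow> bool" where
  "diagonal_matrix M \<longleftrightarrow> (\<forall>i j. i \<noteq> j \<longrightarrow> M $ i $ j = 0)"

definition pos_def :: "real^'n^'n \<Rightarrow> bool" where
  "pos_def M \<longleftrightarrow> symmetric_matrix M \<and> (\<forall>x. x \<noteq> 0 \<longrightarrow> 0 < x \<bullet> (M *v x))"

definition pos_semidef :: "real^'n^'n \<Rightarrow> bool" where
  "pos_semidef M \<longleftrightarrow> symmetric_matrix M \<and> (\<forall>x. 0 \<le> x \<bullet> (M *v x))"

definition neg_semidef :: "real^'n^'n \<Rightarrow> bool" where
  "neg_semidef M \<longleftrightarrow> symmetric_matrix M \<and> (\<forall>x. x \<bullet> (M *v x) \<le> 0)"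


section \<open>Signals\<close>

text \<open>A signal on the nonnegative reals is a function on all reals whose values at negative
  times are irrelevant.\<close>

definition L2e :: "(real \<Rightarrow> real^'n) set" where
  "L2e = {v. \<forall>T>0. v \<in> borel_measurable (lebesgue_on {0..T}) \<and>
                   integrable (lebesgue_on {0..T}) (\<lambda>t. (norm (v t))\<^sup>2)}"

definition abs_continuous_on :: "real set \<Rightarrow> (real \<Rightarrow> 'a::metric_space) \<Rightarrow> bool" where
  "abs_continuous_on I f \<longleftrightarrow>
     (\<forall>\<epsilon>>0. \<exists>\<delta>>0. \<forall>D. finite D \<and> (\<forall>(a, b)\<in>D. a \<le> b \<and> {a..b} \<subseteq> I) \<and>
        pairwise (\<lambda>(a, b) (c, d). {a<..<b} \<inter> {c<..<d} = {}) D \<and>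
        (\<Sum>(a, b)\<in>D. b - a) < \<delta> \<longrightarrow> (\<Sum>(a, b)\<in>D. dist (f a) (f b)) < \<epsilon>)"

text \<open>State trajectories live on an unbounded interval; as usual for Caratheodory solutions,
  absolute continuity is required on each compact subinterval.\<close>

definition abs_continuous :: "(real \<Rightarrow> 'a::metric_space) \<Rightarrow> bool" where
  "abs_continuous f \<longleftrightarrow> (\<forall>T>0. abs_continuous_on {0..T} f)"


section \<open>Uncertainty\<close>

type_synonym 'u operator = "(real \<Rightarrow> real^'u) \<Rightarrow> real \<Rightarrow> real^'u"

definition truncation :: "real \<Rightarrow> (real \<Rightarrow> real^'n) \<Rightarrow> real \<Rightarrow> real^'n" where
  "truncation T v t = (if 0 \<le> t \<and> t \<le> T then v t else 0)"

text \<open>Outputs of operators are compared up to null sets, as elements of the extended space.\<close>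

definition causal :: "('u::finite) operator \<Rightarrow> bool" where
  "causal \<Delta> \<longleftrightarrow> (\<forall>v\<in>L2e. \<forall>T\<ge>0. AE t in lebesgue.
     truncation T (\<Delta> v) t = truncation T (\<Delta> (truncation T v)) t)"

definition diagonal_operator :: "('u::finite) operator \<Rightarrow> bool" where
  "diagonal_operator \<Delta> \<longleftrightarrow> (\<exists>\<Delta>i :: 'u \<Rightarrow> (real \<Rightarrow> real) \<Rightarrow> real \<Rightarrow> real.
     \<forall>v\<in>L2e. \<forall>i. AE t in lebesgue. 0 \<le> t \<longrightarrow> \<Delta> v t $ i = \<Delta>i i (\<lambda>s. v s $ i) t)"

definition L2_gain_less :: "('u::finite) operator \<Rightarrow> real \<Rightarrow> bool" where
  "L2_gain_less \<Delta> \<alpha> \<longleftrightarrow> (\<exists>\<gamma>. 0 \<le> \<gamma> \<and> \<gamma> < \<alpha> \<and> (\<forall>v\<in>L2e. \<forall>T\<ge>0.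
     (\<integral>t. (norm (\<Delta> v t))\<^sup>2 \<partial>lebesgue_on {0..T}) \<le>
       \<gamma>\<^sup>2 * (\<integral>t. (norm (v t))\<^sup>2 \<partial>lebesgue_on {0..T})))"


section \<open>Plant, controller and closed loop\<close>

record ('p, 'u, 'y) plant =
  Ap :: "real^'p^'p"
  Bp :: "real^'u^'p"
  Cp :: "real^'p^'y"

record ('p, 'u, 'y) uncertain_plant =
  nominal :: "('p, 'u, 'y) plant"
  skew :: real
  uncertainty :: "'u operator"

definition uncertain_plants ::
    "real \<Rightarrow> real \<Rightarrow> ('p::finite, 'u::finite, 'y::finite) plant \<Rightarrow> ('p, 'u, 'y) uncertain_plant set" where
  "uncertain_plants \<alpha> \<sigma> G = {\<lparr>nominal = G, skew = \<sigma>, uncertainty = \<Delta>\<rparr> | \<Delta>.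
     (\<forall>v\<in>L2e. \<Delta> v \<in> L2e) \<and> causal \<Delta> \<and> diagonal_operator \<Delta> \<and> L2_gain_less \<Delta> \<alpha>}"

text \<open>\<open>'k\<close>, \<open>'f\<close>, \<open>'u\<close>, \<open>'y\<close> index the controller state, the neurons, the controller output and
  the controller input.\<close>

record ('k, 'f, 'u, 'y) nn_controller =
  Ak :: "real^'k^'k"
  Bkw :: "real^'f^'k"
  Bky :: "real^'y^'k"
  Ckv :: "real^'k^'f"
  Dkvw :: "real^'f^'f"
  Dkvy :: "real^'y^'f"
  Cku :: "real^'k^'u"
  Dkuw :: "real^'f^'u"
  Dkuy :: "real^'y^'u"

definition activation :: "(real^'f \<Rightarrow> real^'f) \<Rightarrow> bool" where
  "activation \<phi> \<longleftrightarrow> (\<exists>\<phi>i :: 'f \<Rightarrow> real \<Rightarrow> real.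
     (\<forall>v i. \<phi> v $ i = \<phi>i i (v $ i)) \<and>
     (\<forall>i s. 0 \<le> \<phi>i i s * (s - \<phi>i i s)) \<and>
     (\<forall>i a b. a \<noteq> b \<longrightarrow> 0 \<le> (\<phi>i i a - \<phi>i i b) / (a - b) \<and> (\<phi>i i a - \<phi>i i b) / (a - b) \<le> 1))"

definition closed_loop_trajectory ::
    "('p::finite, 'u::finite, 'y::finite) uncertain_plant \<Rightarrow> (real^'f \<Rightarrow> real^'f) \<Rightarrow>
     ('k::finite, 'f::finite, 'u, 'y) nn_controller \<Rightarrow> (real \<Rightarrow> (real^'p) \<times> (real^'k)) \<Rightarrow> bool" where
  "closed_loop_trajectory P \<phi> K x \<longleftrightarrow> abs_continuous x \<and>
     (\<exists>v\<^sub>p\<in>L2e. \<exists>v\<^sub>k\<in>L2e. \<exists>w\<^sub>p\<in>L2e. \<exists>w\<^sub>k\<in>L2e. \<exists>u u' y.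
        AE t in lebesgue. 0 \<le> t \<longrightarrow>
          (let x\<^sub>p = (\<lambda>s. fst (x s)); x\<^sub>k = (\<lambda>s. snd (x s)); G = nominal P; \<sigma> = skew P in
           (x\<^sub>p has_vector_derivative (Ap G *v x\<^sub>p t + Bp G *v u t)) (at t within {0..}) \<and>
           y t = Cp G *v x\<^sub>p t \<and>
           u t = v\<^sub>p t + ((1 - \<sigma>) / 2) *\<^sub>R w\<^sub>p t \<and>
           v\<^sub>p t = u' t + ((1 + \<sigma>) / 2) *\<^sub>R w\<^sub>p t \<and>
           w\<^sub>p t = uncertainty P v\<^sub>p t \<and>
           (x\<^sub>k has_vector_derivative (Ak K *v x\<^sub>k t + Bkw K *v w\<^sub>k t + Bky K *v y t))
             (at t within {0..}) \<and>
           v\<^sub>k t = Ckv K *v x\<^sub>k t + Dkvw K *v w\<^sub>k t + Dkvy K *v y t \<and>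
           u' t = Cku K *v x\<^sub>k t + Dkuw K *v w\<^sub>k t + Dkuy K *v y t \<and>
           w\<^sub>k t = \<phi> (v\<^sub>k t)))"

definition stabilizes ::
    "('k::finite, 'f::finite, 'u::finite, 'y::finite) nn_controller \<Rightarrow> (real^'f \<Rightarrow> real^'f) \<Rightarrow>
     ('p::finite, 'u, 'y) uncertain_plant \<Rightarrow> bool" where
  "stabilizes K \<phi> P \<longleftrightarrow> (\<forall>\<epsilon>>0. \<exists>\<delta>>0. \<forall>x. closed_loop_trajectory P \<phi> K x \<and> norm (x 0) < \<delta> \<longrightarrow>
     (\<forall>t\<ge>0. norm (x t) < \<epsilon>))"

definition disk_margin ::
    "real \<Rightarrow> real \<Rightarrow> ('p::finite, 'u::finite, 'y::finite) plant \<Rightarrow> (real^'f \<Rightarrow> real^'f) \<Rightarrow>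
     ('k::finite, 'f::finite, 'u, 'y) nn_controller \<Rightarrow> bool" where
  "disk_margin \<alpha> \<sigma> G \<phi> K \<longleftrightarrow> (\<forall>P\<in>uncertain_plants \<alpha> \<sigma> G. stabilizes K \<phi> P)"


section \<open>Reconstruction equations\<close>

text \<open>\<open>hDkvy\<close> and \<open>hDkvw\<close> stand for the hatted synthesis variables, \<open>Duw\<close> for the
  component of the synthesis variables that the controller inherits unchanged.\<close>

definition reconstruction ::
    "('p::finite, 'u::finite, 'y::finite) plant \<Rightarrow> real^'p^'p \<Rightarrow> real^'p^'p \<Rightarrow>
     real^('p + 'y)^('p + 'u) \<Rightarrow> real^'f^'p \<Rightarrow> real^'p^'f \<Rightarrow> real^'f^'u \<Rightarrow>
     real^'y^'f \<Rightarrow> real^'f^'f \<Rightarrow> real^'f^'f \<Rightarrow> real^'p^'p \<Rightarrow> real^'p^'p \<Rightarrow>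
     ('p, 'f::finite, 'u, 'y) nn_controller \<Rightarrow> bool" where
  "reconstruction G S R NA NB NC Duw hDkvy hDkvw \<Lambda>k U V K \<longleftrightarrow>
     V ** transpose U = mat 1 - R ** S \<and>
     Dkuw K = Duw \<and>
     NA = ((S ** Ap G ** R ||| 0) === (0 ||| 0)) +
          ((U ||| S ** Bp G) === (0 ||| mat 1)) **
          ((Ak K ||| Bky K) === (Cku K ||| Dkuy K)) **
          ((transpose V ||| 0) === (Cp G ** R ||| mat 1)) \<and>
     NB = S ** Bp G ** Dkuw K + U ** Bkw K \<and>
     NC = \<Lambda>k ** Dkvy K ** Cp G ** R + \<Lambda>k ** Ckv K ** transpose V \<and>
     hDkvy = \<Lambda>k ** Dkvy K \<and>
     hDkvw = \<Lambda>k ** Dkvw K"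

end

(* Take V = I and U = I - SR in the reconstruction.  In the coordinates z1 = x_k, z2 = x_p - R x_k the
   storage function z^T [[R, I], [I, S]] z is positive definite by the coupling condition, and evaluating
   the LMI at (z1, z2, w_p, w_k, alpha L v_p) bounds its derivative along a trajectory by
   w_p^T Lambda_p w_p - alpha^2 v_p^T Lambda_p v_p, the activation contributing only through its sector
   bound.  Since Delta_p and Lambda_p are diagonal, the gain bound holds channel by channel, so this
   supply rate has nonpositive integral and the storage function never exceeds its initial value. *)

theory Submission
  imports Defs
begin

text \<open>The coordinates come from the linearizing change of variables of output-feedback
  synthesis. With V = I the matrix Y = [[R, I], [I, 0]] sends (z1, z2) to (x_p, x_k), and the
  storage function is x^T X x for the X with X Y = [[I, S], [0, U^T]]. Since Y^T X Y is the coupling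
  matrix, X itself never has to be formed. The coupling condition also makes U invertible, which is
  what makes the reconstruction equations solvable with V = I. The value of the last LMI coordinate
  r is a Schur complement step: r enters through 2 <r, s> - <r, r> with s = \<alpha> L v_p, and r =
  s maximizes this to |s|^2. The analytic obstacle is that a trajectory obeys its equations only off
  a null set, while the supply rate has a sign only after integration over [0, T]. Storage is
  therefore compared between the times 0 and T alone, and this needs the fundamental theorem of
  calculus for absolutely continuous functions, proved here directly from the gauge definition of
  the integral.\<close>

section \<open>Absolutely continuous functions\<close>

text \<open>Bridges two languages: absolute continuity speaks of finite sets of endpoint pairs, the
  gauge integral of tagged intervals. The total length of the pairs is the measure of the union,
  because the intervals do not overlap.\<close>

lemma abs_continuous_on_small_sum:
  assumes ac: "abs_continuous_on {a..b} f" and e: "0 < e"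
  obtains d where "0 < d"
    "\<And>q. q tagged_partial_division_of {a..b::real} \<Longrightarrow> measure lebesgue (\<Union>(snd ` q)) < d
      \<Longrightarrow> (\<Sum>(x,K)\<in>q. dist (f (Inf K)) (f (Sup K))) < e"
proof -
  obtain d where "d > 0" and
    d: "\<forall>D. finite D \<and> (\<forall>(u, v)\<in>D. u \<le> v \<and> {u..v} \<subseteq> {a..b}) \<and>
        pairwise (\<lambda>(u, v) (u', v'). {u<..<v} \<inter> {u'<..<v'} = {}) D \<and>
        (\<Sum>(u, v)\<in>D. v - u) < d \<longrightarrow> (\<Sum>(u, v)\<in>D. dist (f u) (f v)) < e"
    using ac e by (auto simp only: abs_continuous_on_def)
  show thesis
  proof (rule that[OF \<open>d > 0\<close>])
    fix q assume q: "q tagged_partial_division_of {a..b}" and small: "measure lebesgue (\<Union>(snd ` q)) < d"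
    have fin: "finite q" using tagged_partial_division_ofD(1)[OF q] .
    have K: "K = {Inf K..Sup K} \<and> Inf K \<le> Sup K \<and> K \<subseteq> {a..b}" if xK: "K \<in> snd ` q" for K
    proof -
      obtain x where x: "(x, K) \<in> q" using xK by auto
      obtain u v where "K = cbox u v" using tagged_partial_division_ofD(4)[OF q x] by blast
      moreover have "x \<in> K" "K \<subseteq> {a..b}" using tagged_partial_division_ofD(2,3)[OF q x] by auto
      ultimately show ?thesis by auto
    qed
    define E where "E = (\<lambda>K::real set. (Inf K, Sup K)) ` snd ` q"
    have EK: "inj_on (\<lambda>K::real set. (Inf K, Sup K)) (snd ` q)"
    proof (rule inj_onI)
      fix K K' assume "K \<in> snd ` q" "K' \<in> snd ` q" "(Inf K, Sup K) = (Inf K', Sup K')"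
      then show "K = K'" using K[of K] K[of K'] by simp
    qed
    have div: "snd ` q division_of \<Union>(snd ` q)" by (rule partial_division_of_tagged_division[OF q])
    have len: "Sup K - Inf K = measure lebesgue K" if "K \<in> snd ` q" for K
      using K[OF that]
      by (metis atLeastAtMost_borel content_real measure_completion sets_lborel)
    have "(\<Sum>(u, v)\<in>E. v - u) = (\<Sum>K\<in>snd ` q. measure lebesgue K)"
      unfolding E_def sum.reindex[OF EK] by (intro sum.cong) (simp_all add: len)
    also have "\<dots> < d" using content_division[OF div] small by simp
    finally have sd: "(\<Sum>(u, v)\<in>E. v - u) < d" .
    have "(\<Sum>(u, v)\<in>E. dist (f u) (f v)) < e"
    proof (rule d[rule_format], intro conjI sd)
      show "finite E" using fin by (simp add: E_def)
      show "\<forall>(u, v)\<in>E. u \<le> v \<and> {u..v} \<subseteq> {a..b}" using K unfolding E_def by blast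
      show "pairwise (\<lambda>(u, v) (u', v'). {u<..<v} \<inter> {u'<..<v'} = {}) E"
        unfolding pairwise_def
      proof (intro ballI impI)
        fix z z' assume zE: "z \<in> E" "z' \<in> E" and "z \<noteq> z'"
        moreover obtain u v u' v' where z: "z = (u, v)" "z' = (u', v')" by (metis prod.collapse)
        ultimately have E: "(u,v) \<in> E" "(u',v') \<in> E" and ne: "\<not> (u = u' \<and> v = v')" by auto
        have E': "{u..v} \<in> snd ` q \<and> u \<le> v" if uvE: "(u,v) \<in> E" for u v
        proof -
          obtain K' where "K' \<in> snd ` q" "u = Inf K'" "v = Sup K'" using uvE by (auto simp: E_def)
          then show ?thesis using K[of K'] by simp
        qed
        have "{u..v} \<noteq> {u'..v'}" using E'[OF E(1)] E'[OF E(2)] ne by (simp add: Icc_eq_Icc)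
        then have "interior {u..v} \<inter> interior {u'..v'} = {}"
          using division_ofD(5)[OF div] E'[OF E(1)] E'[OF E(2)] by blast
        then show "(\<lambda>(u, v) (u', v'). {u<..<v} \<inter> {u'<..<v'} = {}) z z'" by (simp add: z)
      qed
    qed
    also have "(\<Sum>(u, v)\<in>E. dist (f u) (f v)) = (\<Sum>K\<in>snd ` q. dist (f (Inf K)) (f (Sup K)))"
      unfolding E_def sum.reindex[OF EK] by (intro sum.cong) simp_all
    \<comment> \<open>\<open>snd\<close> need not be injective on \<open>q\<close>: a degenerate
      interval may carry several tags. Any repeated interval has empty interior, hence equal
      endpoints, and contributes zero.\<close>
    also have "\<dots> = (\<Sum>(x,K)\<in>q. dist (f (Inf K)) (f (Sup K)))"
    proof -
      have "(\<Sum>K\<in>snd ` q. dist (f (Inf K)) (f (Sup K))) = (\<Sum>z\<in>q. dist (f (Inf (snd z))) (f (Sup (snd z))))"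
      proof (rule sum.reindex_nontrivial[OF fin, unfolded comp_def])
        fix z z' assume z: "z \<in> q" "z' \<in> q" "z \<noteq> z'" "snd z = snd z'"
        then have "(fst z, snd z) \<in> q" "(fst z', snd z') \<in> q" "(fst z, snd z) \<noteq> (fst z', snd z')"
          unfolding prod.collapse by blast+
        then have "interior (snd z) \<inter> interior (snd z') = {}"
          by (rule tagged_partial_division_ofD(5)[OF q])
        then have "interior (snd z) = {}" using z by simp
        moreover have "snd z = {Inf (snd z)..Sup (snd z)}" "Inf (snd z) \<le> Sup (snd z)"
          using K[of "snd z"] z(1) by auto
        ultimately have "Inf (snd z) = Sup (snd z)"
          by (metis interior_atLeastAtMost_real greaterThanLessThan_empty_iff order_antisym)
        then show "dist (f (Inf (snd z))) (f (Sup (snd z))) = 0" by simp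
      qed
      then show ?thesis by (simp add: case_prod_beta)
    qed
    finally show "(\<Sum>(x,K)\<in>q. dist (f (Inf K)) (f (Sup K))) < e" .
  qed
qed

text \<open>The exceptional set may be any null set, on which a merely continuous function could
  still grow, as the Cantor function does; absolute continuity excludes this. Integrability of
  \<open>f'\<close> is part of the conclusion.\<close>

theorem fundamental_theorem_of_calculus_abs_continuous:
  fixes f :: "real \<Rightarrow> 'a::banach"
  assumes ab: "a \<le> b" and ac: "abs_continuous_on {a..b} f" and N: "negligible N"
    and vecd: "\<And>x. x \<in> {a..b} - N \<Longrightarrow> (f has_vector_derivative f' x) (at x within {a..b})"
  shows "(f' has_integral (f b - f a)) {a..b}"
proof (rule has_integral_spike[OF N])
  \<comment> \<open>With the integrand zero on \<open>N\<close>, an interval tagged there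
    contributes only the increment of \<open>f\<close> to the Riemann sum error.\<close>
  define g where "g x = (if x \<in> N then 0 else f' x)" for x
  show "f' x = g x" if "x \<in> {a..b} - N" for x using that by (simp add: g_def)
  show "(g has_integral (f b - f a)) {a..b}"
  proof (cases "a = b")
    case True then show ?thesis by (simp add: has_integral_refl)
  next
    case False
    with ab have ab': "a < b" by simp
    show ?thesis unfolding has_integral_factor_content_real
    proof (intro allI impI)
      fix e :: real assume e: "e > 0"
      \<comment> \<open>Tags outside \<open>N\<close> are handled by differentiability; the intervals tagged in \<open>N\<close> lie in an
        open set of small measure, where absolute continuity applies.\<close>
      then have "\<forall>x. \<exists>d>0. x \<in> {a..b} - N \<longrightarrow>
         (\<forall>y\<in>{a..b}. norm (y-x) < d \<longrightarrow> norm (f y - f x - (y-x) *\<^sub>R f' x) \<le> (e/2) * norm (y-x))"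
        using vecd[unfolded has_vector_derivative_def has_derivative_within_alt]
        by (metis half_gt_zero)
      then obtain d where d0: "\<And>x. 0 < d x" and
        d: "\<And>x y. \<lbrakk>x \<in> {a..b} - N; y \<in> {a..b}; norm (y-x) < d x\<rbrakk>
                        \<Longrightarrow> norm (f y - f x - (y-x) *\<^sub>R f' x) \<le> (e/2) * norm (y-x)"
        by metis
      have "e/2 * (b - a) > 0" using e ab' by simp
      then obtain \<delta> where "\<delta> > 0" and \<delta>: "\<And>q. q tagged_partial_division_of {a..b}
          \<Longrightarrow> measure lebesgue (\<Union>(snd ` q)) < \<delta>
          \<Longrightarrow> (\<Sum>(x,K)\<in>q. dist (f (Inf K)) (f (Sup K))) < e/2 * (b - a)"
        using abs_continuous_on_small_sum[OF ac] by blast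
      have "N \<in> lmeasurable" "measure lebesgue N = 0"
        using N by (simp_all add: negligible_imp_measurable negligible_imp_measure0)
      \<comment> \<open>A gauge needs open sets, so the null set is enlarged to an open set by outer
        regularity.\<close>
      obtain T where T: "open T" "N \<subseteq> T" "T - N \<in> lmeasurable"
          "emeasure lebesgue (T - N) < ennreal \<delta>"
        using sets_lebesgue_outer_open[of N \<delta>] \<open>\<delta> > 0\<close> \<open>N \<in> lmeasurable\<close> by blast
      have T_eq: "T = (T - N) \<union> N" using T by blast
      have T_meas: "T \<in> lmeasurable"
        by (subst T_eq) (intro fmeasurable.Un T \<open>N \<in> lmeasurable\<close>)
      have "measure lebesgue (T - N) < \<delta>"
        using T(3,4) \<open>\<delta> > 0\<close> by (simp add: emeasure_eq_measure2 ennreal_less_iff)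
      moreover have "measure lebesgue T \<le> measure lebesgue (T - N) + measure lebesgue N"
        by (subst T_eq) (intro measure_Un_le fmeasurableD T(3) \<open>N \<in> lmeasurable\<close>)
      ultimately have T_small: "measure lebesgue T < \<delta>"
        using \<open>measure lebesgue N = 0\<close> by simp
      define \<Gamma> where "\<Gamma> x = (if x \<in> N then T else ball x (d x))" for x
      show "\<exists>\<Gamma>. gauge \<Gamma> \<and> (\<forall>p. p tagged_division_of {a..b} \<and> \<Gamma> fine p \<longrightarrow>
          norm ((\<Sum>(x, k)\<in>p. measure lborel k *\<^sub>R g x) - (f b - f a)) \<le> e * measure lborel {a..b})"
      proof (intro exI[of _ \<Gamma>] conjI allI impI)
        show "gauge \<Gamma>" using T d0 by (auto simp: gauge_def \<Gamma>_def)
        fix p assume "p tagged_division_of {a..b} \<and> \<Gamma> fine p"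
        then have p: "p tagged_division_of {a..b}" and fine: "\<Gamma> fine p" by auto
        have fin: "finite p" using p by blast
        have pp: "p tagged_partial_division_of {a..b}" using p by (simp add: tagged_division_of_def)
        have K: "\<exists>u v. K = {u..v} \<and> u \<le> v \<and> {u..v} \<subseteq> {a..b} \<and> x \<in> {u..v}" if xK: "(x,K) \<in> p" for x K
        proof -
          obtain u v where "K = cbox u v" using tagged_division_ofD(4)[OF p xK] by blast
          moreover have "x \<in> K" "K \<subseteq> {a..b}" using tagged_division_ofD(2,3)[OF p xK] by auto
          ultimately show ?thesis by auto
        qed
        define q where "q = {z\<in>p. fst z \<in> N}"
        have "q \<subseteq> p" by (auto simp: q_def)
        have q: "q tagged_partial_division_of {a..b}"
          using tagged_partial_division_subset[OF pp \<open>q \<subseteq> p\<close>] .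
        have "\<Union>(snd ` q) \<subseteq> T" using fine by (force simp: q_def \<Gamma>_def fine_def)
        moreover have "\<Union>(snd ` q) \<in> sets lebesgue"
          using lmeasurable_division[OF partial_division_of_tagged_division[OF q]] by blast
        ultimately have "measure lebesgue (\<Union>(snd ` q)) < \<delta>"
          using measure_mono_fmeasurable[of "\<Union>(snd ` q)" T lebesgue] T_meas T_small by force
        then have bad: "(\<Sum>(x,K)\<in>q. dist (f (Inf K)) (f (Sup K))) \<le> e/2 * (b - a)"
          using \<delta>[OF q] by fastforce
        let ?h = "\<lambda>(x, K). measure lborel K *\<^sub>R g x - (f (Sup K) - f (Inf K))"
        have "norm (sum ?h q) \<le> (\<Sum>(x,K)\<in>q. dist (f (Inf K)) (f (Sup K)))"
          by (rule sum_norm_le) (auto simp: q_def g_def dist_norm norm_minus_commute)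
        with bad have bad': "norm (sum ?h q) \<le> e/2 * (b - a)" by linarith
        have "norm (sum ?h (p - q)) \<le> (\<Sum>(x,K)\<in>p-q. e/2 * (Sup K - Inf K))"
        proof (rule sum_norm_le, clarify)
          fix x K assume xK: "(x,K) \<in> p" "(x,K) \<notin> q"
          then have xN: "x \<notin> N" by (auto simp: q_def)
          obtain u v where uv: "K = {u..v}" "u \<le> v" "{u..v} \<subseteq> {a..b}" "x \<in> {u..v}" using K xK by blast
          then have x: "x \<in> {a..b} - N" using xN by auto
          have "K \<subseteq> ball x (d x)" using fine xK xN by (force simp: fine_def \<Gamma>_def)
          then have uvd: "norm (u - x) < d x" "norm (v - x) < d x"
            using uv(1,2) by (auto simp: dist_real_def subset_iff abs_minus_commute)
          have uvab: "u \<in> {a..b}" "v \<in> {a..b}" using uv by auto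
          \<comment> \<open>The tag lies between the endpoints, so the errors from \<open>x\<close>
            to \<open>u\<close> and from \<open>x\<close> to \<open>v\<close> add up to a multiple
            of exactly v - u.\<close>
          have "norm ((v - u) *\<^sub>R f' x - (f v - f u)) =
              norm ((f u - f x - (u - x) *\<^sub>R f' x) - (f v - f x - (v - x) *\<^sub>R f' x))"
            by (simp add: algebra_simps)
          also have "\<dots> \<le> norm (f u - f x - (u - x) *\<^sub>R f' x) + norm (f v - f x - (v - x) *\<^sub>R f' x)"
            by (rule norm_triangle_ineq4)
          also have "\<dots> \<le> (e/2) * norm (u - x) + (e/2) * norm (v - x)"
            using d[OF x uvab(1) uvd(1)] d[OF x uvab(2) uvd(2)] by (rule add_mono)
          also have "\<dots> = e/2 * ((x - u) + (v - x))"
            unfolding distrib_left using uv(4) by simp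
          also have "\<dots> = e/2 * (v - u)" by simp
          finally show "norm (measure lborel K *\<^sub>R g x - (f (Sup K) - f (Inf K))) \<le> e/2 * (Sup K - Inf K)"
            using uv xN by (simp add: g_def)
        qed
        also have "\<dots> \<le> (\<Sum>(x,K)\<in>p. e/2 * (Sup K - Inf K))"
        proof (rule sum_mono2[OF fin])
          fix z assume "z \<in> p - (p - q)"
          then show "0 \<le> (case z of (x, K) \<Rightarrow> e/2 * (Sup K - Inf K))"
            using K[of "fst z" "snd z"] e by (auto simp: case_prod_beta)
        qed auto
        also have "\<dots> = e/2 * (\<Sum>(x,K)\<in>p. Sup K - Inf K)"
          by (simp add: sum_distrib_left case_prod_beta)
        also have "\<dots> = e/2 * (b - a)"
          using additive_tagged_division_1[OF ab p, of "\<lambda>x. x"] by simp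
        finally have good: "norm (sum ?h (p - q)) \<le> e/2 * (b - a)" .
        have "(\<Sum>(x, k)\<in>p. measure lborel k *\<^sub>R g x) - (f b - f a) = sum ?h p"
          using additive_tagged_division_1[OF ab p, of f]
          by (simp add: sum_subtractf case_prod_beta)
        also have "\<dots> = sum ?h (p - q) + sum ?h q"
          by (rule sum.subset_diff[OF \<open>q \<subseteq> p\<close> fin])
        finally have "norm ((\<Sum>(x, k)\<in>p. measure lborel k *\<^sub>R g x) - (f b - f a)) \<le> e/2 * (b-a) + e/2*(b-a)"
          by (simp only: norm_triangle_mono[OF good bad'])
        then show "norm ((\<Sum>(x, k)\<in>p. measure lborel k *\<^sub>R g x) - (f b - f a)) \<le> e * measure lborel {a..b}"
          using ab by simp
      qed
    qed
  qed
qed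

lemma abs_continuous_on_imp_continuous_on:
  assumes "abs_continuous_on {a..b::real} f" shows "continuous_on {a..b} f"
  unfolding continuous_on_iff
proof (intro ballI allI impI)
  fix x e :: real assume x: "x \<in> {a..b}" and e: "0 < e"
  obtain d where "d > 0" and
    d: "\<forall>D. finite D \<and> (\<forall>(u, v)\<in>D. u \<le> v \<and> {u..v} \<subseteq> {a..b}) \<and>
        pairwise (\<lambda>(u, v) (u', v'). {u<..<v} \<inter> {u'<..<v'} = {}) D \<and>
        (\<Sum>(u, v)\<in>D. v - u) < d \<longrightarrow> (\<Sum>(u, v)\<in>D. dist (f u) (f v)) < e"
    using assms e by (auto simp only: abs_continuous_on_def)
  have "dist (f y) (f x) < e" if y: "y \<in> {a..b}" "dist y x < d" for y
  proof (cases "x \<le> y")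
    case True
    then show ?thesis using d[rule_format, of "{(x, y)}"] x y
      by (simp add: dist_real_def dist_commute)
  next
    case False
    then show ?thesis using d[rule_format, of "{(y, x)}"] x y
      by (simp add: dist_real_def)
  qed
  with \<open>d > 0\<close> show "\<exists>d>0. \<forall>y\<in>{a..b}. dist y x < d \<longrightarrow> dist (f y) (f x) < e" by blast
qed

text \<open>The Lipschitz bound is asked only on values taken by \<open>f\<close>, because the
  intended \<open>g\<close> is quadratic and so Lipschitz only on bounded sets.\<close>

lemma abs_continuous_on_lipschitz_compose:
  assumes ac: "abs_continuous_on I f"
    and lip: "\<And>s t. s \<in> I \<Longrightarrow> t \<in> I \<Longrightarrow> dist (g (f s)) (g (f t)) \<le> C * dist (f s) (f t)"
  shows "abs_continuous_on I (\<lambda>t. g (f t))"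
  unfolding abs_continuous_on_def
proof (intro allI impI)
  fix e :: real assume e: "e > 0"
  \<comment> \<open>\<open>C\<close> may be zero or negative, and the tolerance is to be divided by
    a positive constant.\<close>
  define C' where "C' = \<bar>C\<bar> + 1"
  have C': "C' > 0" "C \<le> C'" by (auto simp: C'_def)
  then have "e / C' > 0" using e by simp
  then obtain d where "d > 0" and
    d: "\<forall>D. finite D \<and> (\<forall>(u, v)\<in>D. u \<le> v \<and> {u..v} \<subseteq> I) \<and>
        pairwise (\<lambda>(u, v) (u', v'). {u<..<v} \<inter> {u'<..<v'} = {}) D \<and>
        (\<Sum>(u, v)\<in>D. v - u) < d \<longrightarrow> (\<Sum>(u, v)\<in>D. dist (f u) (f v)) < e / C'"
    using ac by (auto simp only: abs_continuous_on_def)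
  show "\<exists>d>0. \<forall>D. finite D \<and> (\<forall>(u, v)\<in>D. u \<le> v \<and> {u..v} \<subseteq> I) \<and>
        pairwise (\<lambda>(u, v) (u', v'). {u<..<v} \<inter> {u'<..<v'} = {}) D \<and>
        (\<Sum>(u, v)\<in>D. v - u) < d \<longrightarrow> (\<Sum>(u, v)\<in>D. dist (g (f u)) (g (f v))) < e"
  proof (intro exI[of _ d] conjI allI impI \<open>d > 0\<close>)
    fix D assume D: "finite D \<and> (\<forall>(u, v)\<in>D. u \<le> v \<and> {u..v} \<subseteq> I) \<and>
        pairwise (\<lambda>(u, v) (u', v'). {u<..<v} \<inter> {u'<..<v'} = {}) D \<and>
        (\<Sum>(u, v)\<in>D. v - u) < d"
    have "(\<Sum>(u, v)\<in>D. dist (g (f u)) (g (f v))) \<le> (\<Sum>(u, v)\<in>D. C' * dist (f u) (f v))"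
    proof (rule sum_mono, clarify)
      fix u v assume "(u, v) \<in> D"
      then have "u \<le> v \<and> {u..v} \<subseteq> I" using D by blast
      then have "u \<in> I" "v \<in> I" by auto
      from lip[OF this] show "dist (g (f u)) (g (f v)) \<le> C' * dist (f u) (f v)"
        using C' by (meson dual_order.trans mult_right_mono zero_le_dist)
    qed
    also have "\<dots> = C' * (\<Sum>(u, v)\<in>D. dist (f u) (f v))"
      by (simp add: sum_distrib_left case_prod_beta)
    also have "\<dots> < e" using d D C'(1) by (metis (no_types, lifting) mult.commute pos_less_divide_eq)
    finally show "(\<Sum>(u, v)\<in>D. dist (g (f u)) (g (f v))) < e" .
  qed
qed

text \<open>On a compact interval \<open>f\<close> is bounded, and splitting the difference of two
  values of the form by bilinearity gives a Lipschitz constant 2 B k on that range.\<close>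

lemma abs_continuous_on_quadratic:
  fixes f :: "real \<Rightarrow> 'a::real_normed_vector"
  assumes h: "bounded_bilinear h" and ac: "abs_continuous_on {a..b} f"
  shows "abs_continuous_on {a..b} (\<lambda>t. h (f t) (f t))"
proof -
  interpret bounded_bilinear h by fact
  obtain k where k: "k > 0" "\<And>x y. norm (h x y) \<le> norm x * norm y * k" using pos_bounded by blast
  have "bounded (f ` {a..b})"
    using compact_continuous_image[OF abs_continuous_on_imp_continuous_on[OF ac]]
    by (simp add: compact_imp_bounded)
  then obtain B where "B > 0" and B: "\<And>t. t \<in> {a..b} \<Longrightarrow> norm (f t) \<le> B"
    by (auto simp: bounded_pos)
  show ?thesis
  proof (rule abs_continuous_on_lipschitz_compose[OF ac])
    fix s t assume st: "s \<in> {a..b}" "t \<in> {a..b}"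
    have "h (f s) (f s) - h (f t) (f t) = h (f s - f t) (f s) + h (f t) (f s - f t)"
      by (simp add: diff_left diff_right)
    then have "dist (h (f s) (f s)) (h (f t) (f t)) \<le>
        norm (f s - f t) * norm (f s) * k + norm (f t) * norm (f s - f t) * k"
      unfolding dist_norm by (metis add_mono k(2) norm_triangle_le)
    also have "\<dots> = (norm (f s) + norm (f t)) * (k * norm (f s - f t))" by (simp add: algebra_simps)
    also have "\<dots> \<le> (B + B) * (k * norm (f s - f t))"
      using k(1) by (intro mult_right_mono add_mono B st) simp
    finally show "dist (h (f s) (f s)) (h (f t) (f t)) \<le> (2 * B * k) * dist (f s) (f t)"
      by (simp add: dist_norm algebra_simps)
  qed
qed

section \<open>Block matrices and quadratic forms\<close>

text \<open>The constant is the minimum of the form over the unit sphere, attained by compactness;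
  homogeneity of degree two extends the bound to all vectors.\<close>

lemma pos_bilinear_lower_bound:
  fixes h :: "'a::euclidean_space \<Rightarrow> 'a \<Rightarrow> real"
  assumes h: "bounded_bilinear h" and pos: "\<And>x. x \<noteq> 0 \<Longrightarrow> 0 < h x x"
  obtains c where "0 < c" "\<And>x. c * (norm x)\<^sup>2 \<le> h x x"
proof -
  interpret bounded_bilinear h by fact
  have cont: "continuous_on (sphere 0 1) (\<lambda>x. h x x)"
    by (intro continuous_on continuous_on_id)
  have "sphere (0::'a) 1 \<noteq> {}" by simp
  then obtain x0 where x0: "x0 \<in> sphere 0 1" "\<And>x. x \<in> sphere 0 1 \<Longrightarrow> h x0 x0 \<le> h x x"
    using continuous_attains_inf[OF compact_sphere _ cont] by blast
  show thesis
  proof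
    have "x0 \<noteq> 0" using x0(1) by auto
    then show "0 < h x0 x0" by (rule pos)
    fix x :: 'a
    show "h x0 x0 * (norm x)\<^sup>2 \<le> h x x"
    proof (cases "x = 0")
      case True then show ?thesis by (simp add: zero_left)
    next
      case False
      then have "h x0 x0 \<le> h (x /\<^sub>R norm x) (x /\<^sub>R norm x)" by (intro x0(2)) simp
      also have "\<dots> = h x x / (norm x)\<^sup>2"
        by (simp add: scaleR_left scaleR_right power2_eq_square divide_inverse)
      finally show ?thesis using False by (simp add: pos_le_divide_eq)
    qed
  qed
qed

definition vjoin :: "real^'a \<Rightarrow> real^'b \<Rightarrow> real^('a + 'b)" where
  "vjoin x y = (\<chi> i. case i of Inl a \<Rightarrow> x $ a | Inr b \<Rightarrow> y $ b)"

lemma sum_UNIV_Plus: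
  fixes f :: "'a::finite + 'b::finite \<Rightarrow> 'c::comm_monoid_add"
  shows "sum f UNIV = (\<Sum>a\<in>UNIV. f (Inl a)) + (\<Sum>b\<in>UNIV. f (Inr b))"
  by (simp add: UNIV_Plus_UNIV[symmetric] sum.Plus del: UNIV_Plus_UNIV)

lemma inner_vjoin: "vjoin a b \<bullet> vjoin c d = a \<bullet> c + b \<bullet> d"
  by (simp add: inner_vec_def vjoin_def sum_UNIV_Plus)

lemma vcat_mult_vec: "(M === N) *v x = vjoin (M *v x) (N *v x)"
  by (simp add: vec_eq_iff vjoin_def vcat_def matrix_vector_mult_def split: sum.split)

lemma hcat_mult_vjoin: "(M ||| N) *v vjoin a b = M *v a + N *v b"
  by (simp add: vec_eq_iff vjoin_def hcat_def matrix_vector_mult_def sum_UNIV_Plus)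

lemma vcat_mult: "(M === N) ** X = (M ** X === N ** X)"
  by (simp add: vec_eq_iff vcat_def matrix_matrix_mult_def split: sum.split)

lemma mult_hcat: "X ** (M ||| N) = (X ** M ||| X ** N)"
  by (simp add: vec_eq_iff hcat_def matrix_matrix_mult_def split: sum.split)

lemma hcat_mult_vcat: "(M ||| N) ** (P === Q) = M ** P + N ** Q"
  by (simp add: vec_eq_iff hcat_def vcat_def matrix_matrix_mult_def sum_UNIV_Plus)

lemma vcat_add: "(M === N) + (P === Q) = (M + P === N + Q)"
  by (simp add: vec_eq_iff vcat_def split: sum.split)

lemma hcat_add: "(M ||| N) + (P ||| Q) = (M + P ||| N + Q)"
  by (simp add: vec_eq_iff hcat_def split: sum.split)

lemma bounded_linear_vjoin:
  assumes "bounded_linear f" "bounded_linear g"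
  shows "bounded_linear (\<lambda>x. vjoin (f x :: real^'b) (g x :: real^'c))"
proof -
  have "linear (\<lambda>z. vjoin (fst z) (snd z) :: real^('b + 'c))"
    by (rule linearI) (simp_all add: vjoin_def vec_eq_iff split: sum.split)
  then have "bounded_linear (\<lambda>z. vjoin (fst z) (snd z) :: real^('b + 'c))"
    by (simp add: linear_conv_bounded_linear)
  from bounded_linear_compose[OF this bounded_linear_Pair[OF assms]] show ?thesis by simp
qed

lemma inner_transpose_right: "x \<bullet> (transpose A *v y) = y \<bullet> (A *v x)" for A :: "real^'n^'m"
  by (metis dot_lmul_matrix inner_commute transpose_matrix_vector)

lemma inner_transpose_left: "(transpose A *v x) \<bullet> y = x \<bullet> (A *v y)" for A :: "real^'n^'m"
  by (simp add: dot_lmul_matrix)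

lemma inner_symmetric_matrix:
  assumes "symmetric_matrix A" shows "(A *v x) \<bullet> y = x \<bullet> (A *v y)"
  by (metis assms inner_transpose_left symmetric_matrix_def)

lemma transpose_diff: "transpose (A - B) = transpose A - transpose B" for A B :: "real^'n^'m"
  by (simp add: transpose_def vec_eq_iff)

lemma matrix_add_rdistrib: "(A + B) ** C = A ** C + B ** C" for A B :: "real^'n^'m" and C :: "real^'k^'n"
  by (simp add: matrix_matrix_mult_def vec_eq_iff distrib_right sum.distrib)

lemma matrix_zero_mult: "(0 :: real^'n^'m) ** (A :: real^'k^'n) = 0"
  by (simp add: matrix_matrix_mult_def vec_eq_iff)

lemma matrix_vector_mult_minus_left: "(- A) *v x = - (A *v x)" for A :: "real^'n^'m"
  using matrix_vector_mult_diff_rdistrib[of 0 A x] by simp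

text \<open>The function is the quadratic form of the coupling matrix at (z1, z2), written out;
  symmetry of \<open>R\<close> and \<open>S\<close> merges the paired terms of the product
  rule.\<close>

lemma quadratic_has_vector_derivative:
  fixes z1 z2 :: "real \<Rightarrow> real^'p"
  assumes R: "symmetric_matrix R" and S: "symmetric_matrix S"
    and z: "(z1 has_vector_derivative d1) (at t within X)" "(z2 has_vector_derivative d2) (at t within X)"
  shows "((\<lambda>t. z1 t \<bullet> (R *v z1 t) + 2 * (z1 t \<bullet> z2 t) + z2 t \<bullet> (S *v z2 t)) has_vector_derivative
     2 * ((R *v z1 t + z2 t) \<bullet> d1 + (z1 t + S *v z2 t) \<bullet> d2)) (at t within X)"
proof -
  note inn = bounded_bilinear.has_vector_derivative[OF bounded_bilinear_inner]
  note mat = bounded_linear.has_vector_derivative[OF matrix_vector_mul_bounded_linear]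
  have "((\<lambda>t. z1 t \<bullet> (R *v z1 t) + 2 * (z1 t \<bullet> z2 t) + z2 t \<bullet> (S *v z2 t)) has_vector_derivative
     (z1 t \<bullet> (R *v d1) + d1 \<bullet> (R *v z1 t)) + 2 * (z1 t \<bullet> d2 + d1 \<bullet> z2 t)
      + (z2 t \<bullet> (S *v d2) + d2 \<bullet> (S *v z2 t))) (at t within X)"
    by (intro has_vector_derivative_add inn mat z has_vector_derivative_mult_right)
  moreover have "z1 t \<bullet> (R *v d1) = (R *v z1 t) \<bullet> d1" "z2 t \<bullet> (S *v d2) = (S *v z2 t) \<bullet> d2"
    using R S by (simp_all add: inner_symmetric_matrix)
  ultimately show ?thesis by (simp add: algebra_simps inner_commute)
qed

section \<open>Diagonal operators of bounded gain\<close>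

lemma L2e_component_measurable:
  assumes "v \<in> L2e" "0 < T"
  shows "(\<lambda>t. v t $ i) \<in> borel_measurable (lebesgue_on {0..T})"
proof -
  have "(\<lambda>t. v t \<bullet> axis i 1) \<in> borel_measurable (lebesgue_on {0..T})"
    using assms by (intro borel_measurable_inner) (simp_all add: L2e_def)
  then show ?thesis by (simp add: inner_axis)
qed

lemma L2e_component_square_integrable:
  assumes "v \<in> L2e" "0 < T"
  shows "integrable (lebesgue_on {0..T}) (\<lambda>t. (v t $ i)\<^sup>2)"
proof (rule Bochner_Integration.integrable_bound)
  show "integrable (lebesgue_on {0..T}) (\<lambda>t. (norm (v t))\<^sup>2)"
    using assms by (simp add: L2e_def)
  show "(\<lambda>t. (v t $ i)\<^sup>2) \<in> borel_measurable (lebesgue_on {0..T})"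
    using L2e_component_measurable[OF assms] by simp
  show "AE t in lebesgue_on {0..T}. norm ((v t $ i)\<^sup>2) \<le> norm ((norm (v t))\<^sup>2)"
    using component_le_norm_cart by (auto simp: abs_le_square_iff[symmetric])
qed

lemma L2e_single_channel:
  assumes "v \<in> L2e"
  shows "(\<lambda>t. (v t $ i) *\<^sub>R axis i 1) \<in> L2e"
  using L2e_component_measurable[OF assms] L2e_component_square_integrable[OF assms]
  unfolding L2e_def by (simp add: power_mult_distrib)

lemma AE_lebesgue_on_nonneg:
  fixes P :: "real \<Rightarrow> bool"
  assumes "AE t in lebesgue. 0 \<le> t \<longrightarrow> P t"
  shows "AE t in lebesgue_on {0..T}. P t"
  by (subst AE_restrict_space_iff) (use assms in \<open>auto elim: eventually_mono\<close>)

lemma channel_gain: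
  assumes L2e: "\<forall>v\<in>L2e. \<Delta> v \<in> L2e" and diag: "diagonal_operator \<Delta>" and gain: "L2_gain_less \<Delta> \<alpha>"
    and v: "v \<in> L2e" and T: "0 < T"
  shows "(\<integral>t. (\<Delta> v t $ i)\<^sup>2 \<partial>lebesgue_on {0..T}) \<le> \<alpha>\<^sup>2 * (\<integral>t. (v t $ i)\<^sup>2 \<partial>lebesgue_on {0..T})"
proof -
  \<comment> \<open>The \<open>i\<close>-th output channel does not change when all other inputs are switched off.\<close>
  define v' where "v' = (\<lambda>t. (v t $ i) *\<^sub>R axis i 1 :: real^'a)"
  have v': "v' \<in> L2e" unfolding v'_def by (rule L2e_single_channel[OF v])
  obtain \<gamma> where \<gamma>: "0 \<le> \<gamma>" "\<gamma> < \<alpha>" and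
    g: "\<forall>v\<in>L2e. \<forall>T\<ge>0. (\<integral>t. (norm (\<Delta> v t))\<^sup>2 \<partial>lebesgue_on {0..T}) \<le>
       \<gamma>\<^sup>2 * (\<integral>t. (norm (v t))\<^sup>2 \<partial>lebesgue_on {0..T})"
    using gain unfolding L2_gain_less_def by blast
  obtain \<Delta>i where \<Delta>i: "\<And>v i. v \<in> L2e \<Longrightarrow> AE t in lebesgue. 0 \<le> t \<longrightarrow> \<Delta> v t $ i = \<Delta>i i (\<lambda>s. v s $ i) t"
    using diag unfolding diagonal_operator_def by blast
  have same: "(\<lambda>s. v' s $ i) = (\<lambda>s. v s $ i)" by (simp add: v'_def)
  have "AE t in lebesgue. 0 \<le> t \<longrightarrow> \<Delta> v t $ i = \<Delta> v' t $ i"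
    using \<Delta>i[OF v, of i] \<Delta>i[OF v', of i] unfolding same by eventually_elim simp
  then have ae: "AE t in lebesgue_on {0..T}. (\<Delta> v t $ i)\<^sup>2 = (\<Delta> v' t $ i)\<^sup>2"
    by (rule eventually_mono[OF AE_lebesgue_on_nonneg]) simp
  have D: "\<Delta> v \<in> L2e" "\<Delta> v' \<in> L2e" using L2e v v' by auto
  have "(\<integral>t. (\<Delta> v t $ i)\<^sup>2 \<partial>lebesgue_on {0..T}) = (\<integral>t. (\<Delta> v' t $ i)\<^sup>2 \<partial>lebesgue_on {0..T})"
    using L2e_component_square_integrable[OF D(1) T, of i] L2e_component_square_integrable[OF D(2) T, of i] ae
    by (intro integral_cong_AE borel_measurable_integrable)
  also have "\<dots> \<le> (\<integral>t. (norm (\<Delta> v' t))\<^sup>2 \<partial>lebesgue_on {0..T})"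
  proof (rule integral_mono)
    show "integrable (lebesgue_on {0..T}) (\<lambda>t. (norm (\<Delta> v' t))\<^sup>2)" using D(2) T by (simp add: L2e_def)
    show "(\<Delta> v' t $ i)\<^sup>2 \<le> (norm (\<Delta> v' t))\<^sup>2" for t
      using component_le_norm_cart[of "\<Delta> v' t" i] by (simp add: abs_le_square_iff[symmetric])
  qed (rule L2e_component_square_integrable[OF D(2) T])
  also have "\<dots> \<le> \<gamma>\<^sup>2 * (\<integral>t. (norm (v' t))\<^sup>2 \<partial>lebesgue_on {0..T})"
    using g v' T by simp
  also have "\<dots> = \<gamma>\<^sup>2 * (\<integral>t. (v t $ i)\<^sup>2 \<partial>lebesgue_on {0..T})"
    by (simp add: v'_def power_mult_distrib)
  also have "\<dots> \<le> \<alpha>\<^sup>2 * (\<integral>t. (v t $ i)\<^sup>2 \<partial>lebesgue_on {0..T})"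
    using \<gamma> by (intro mult_right_mono power_mono) auto
  finally show ?thesis .
qed

section \<open>Quadratic forms with a diagonal weight, and their integrals along signals\<close>

lemma inner_diagonal_matrix:
  fixes D :: "real^'n^'n"
  assumes "diagonal_matrix D"
  shows "x \<bullet> (D *v y) = (\<Sum>i\<in>UNIV. D $ i $ i * (x $ i * y $ i))"
proof -
  have "(D *v y) $ i = D $ i $ i * y $ i" for i
  proof -
    have "(D *v y) $ i = (\<Sum>j\<in>UNIV. if j = i then D $ i $ i * y $ i else 0)"
      unfolding matrix_vector_mult_def vec_lambda_beta
      using assms by (intro sum.cong) (auto simp: diagonal_matrix_def)
    then show ?thesis by simp
  qed
  then show ?thesis by (simp add: inner_vec_def algebra_simps)
qed

lemma pos_semidef_diagonal_nonneg:
  assumes "pos_semidef D" shows "0 \<le> D $ i $ i"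
proof -
  have "0 \<le> axis i 1 \<bullet> (D *v axis i 1)" using assms by (simp add: pos_semidef_def)
  then show ?thesis by (simp add: matrix_vector_mul_component inner_axis inner_axis')
qed

lemma integrable_diagonal_form:
  assumes "v \<in> L2e" "0 < T" "diagonal_matrix D"
  shows "integrable (lebesgue_on {0..T}) (\<lambda>t. v t \<bullet> (D *v v t))"
  unfolding inner_diagonal_matrix[OF assms(3)] power2_eq_square[symmetric]
  by (intro Bochner_Integration.integrable_sum integrable_mult_right
      L2e_component_square_integrable[OF assms(1,2)])

lemma integral_diagonal_form:
  assumes "v \<in> L2e" "0 < T" "diagonal_matrix D"
  shows "(\<integral>t. v t \<bullet> (D *v v t) \<partial>lebesgue_on {0..T}) =
    (\<Sum>i\<in>UNIV. D $ i $ i * (\<integral>t. (v t $ i)\<^sup>2 \<partial>lebesgue_on {0..T}))"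
  unfolding inner_diagonal_matrix[OF assms(3)] power2_eq_square[symmetric]
  by (subst Bochner_Integration.integral_sum)
     (auto intro!: integrable_mult_right L2e_component_square_integrable[OF assms(1,2)])

lemma weighted_gain:
  assumes L2e: "\<forall>v\<in>L2e. \<Delta> v \<in> L2e" and diag: "diagonal_operator \<Delta>" and gain: "L2_gain_less \<Delta> \<alpha>"
    and v: "v \<in> L2e" and T: "0 < T"
    and D: "pos_semidef D" "diagonal_matrix D"
  shows "(\<integral>t. \<Delta> v t \<bullet> (D *v \<Delta> v t) \<partial>lebesgue_on {0..T})
    \<le> \<alpha>\<^sup>2 * (\<integral>t. v t \<bullet> (D *v v t) \<partial>lebesgue_on {0..T})"
proof -
  have "\<Delta> v \<in> L2e" using L2e v by simp
  then have "(\<integral>t. \<Delta> v t \<bullet> (D *v \<Delta> v t) \<partial>lebesgue_on {0..T})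
      = (\<Sum>i\<in>UNIV. D $ i $ i * (\<integral>t. (\<Delta> v t $ i)\<^sup>2 \<partial>lebesgue_on {0..T}))"
    by (rule integral_diagonal_form[OF _ T D(2)])
  also have "\<dots> \<le> (\<Sum>i\<in>UNIV. D $ i $ i * (\<alpha>\<^sup>2 * (\<integral>t. (v t $ i)\<^sup>2 \<partial>lebesgue_on {0..T})))"
    by (intro sum_mono mult_left_mono channel_gain[OF L2e diag gain v T] pos_semidef_diagonal_nonneg D)
  also have "\<dots> = \<alpha>\<^sup>2 * (\<integral>t. v t \<bullet> (D *v v t) \<partial>lebesgue_on {0..T})"
    by (simp add: integral_diagonal_form[OF v T D(2)] sum_distrib_left algebra_simps)
  finally show ?thesis .
qed

text \<open>The bound \<open>g\<close> may change sign, so \<open>f\<close> need not be monotone;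
  only the integral of \<open>g\<close> over the whole horizon is controlled, which suffices to
  compare the two end values.\<close>

lemma abs_continuous_le_initial_value:
  fixes f g :: "real \<Rightarrow> real"
  assumes ac: "abs_continuous_on {0..T} f" and T: "0 < T"
    and g: "integrable (lebesgue_on {0..T}) g" "(\<integral>t. g t \<partial>lebesgue_on {0..T}) \<le> 0"
    and der: "AE t in lebesgue. 0 \<le> t \<longrightarrow> (\<exists>d\<le>g t. (f has_vector_derivative d) (at t within {0..}))"
  shows "f T \<le> f 0"
proof -
  obtain N where N: "N \<in> null_sets lebesgue"
    "{t. \<not> (0 \<le> t \<longrightarrow> (\<exists>d\<le>g t. (f has_vector_derivative d) (at t within {0..})))} \<subseteq> N"
    using der unfolding eventually_ae_filter by auto
  have negN: "negligible N" using N(1) by (simp add: negligible_iff_null_sets)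
  have "\<forall>t. \<exists>d. t \<in> {0..T} - N \<longrightarrow> d \<le> g t \<and> (f has_vector_derivative d) (at t within {0..})"
    using N(2) by fastforce
  then obtain f' where f': "\<And>t. t \<in> {0..T} - N \<Longrightarrow> f' t \<le> g t"
    "\<And>t. t \<in> {0..T} - N \<Longrightarrow> (f has_vector_derivative f' t) (at t within {0..})" by metis
  have "(f has_vector_derivative f' t) (at t within {0..T})" if "t \<in> {0..T} - N" for t
    using has_vector_derivative_within_subset[OF f'(2)[OF that], of "{0..T}"] by auto
  then have F: "(f' has_integral (f T - f 0)) {0..T}"
    using T by (intro fundamental_theorem_of_calculus_abs_continuous[OF _ ac negN]) auto
  have G: "(g has_integral (\<integral>t. g t \<partial>lebesgue_on {0..T})) {0..T}"
    by (rule has_integral_integral_lebesgue_on[OF g(1)]) simp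
  \<comment> \<open>Nothing is known about \<open>f'\<close> on \<open>N\<close>; putting
    \<open>g\<close> there makes the comparison of integrands valid at every point.\<close>
  have F': "((\<lambda>t. if t \<in> N then g t else f' t) has_integral (f T - f 0)) {0..T}"
    by (rule has_integral_spike[OF negN _ F]) simp
  have "f T - f 0 \<le> (\<integral>t. g t \<partial>lebesgue_on {0..T})"
    by (rule has_integral_le[OF F' G]) (use f' in auto)
  with g(2) show ?thesis by simp
qed

section \<open>Dissipation and stability\<close>

text \<open>\<open>ut\<close> is the controller output expressed in the synthesis variables, so that
  the plant input is \<open>ut\<close> plus \<open>wp\<close>. The final square replaces the last
  block row and column of the LMI.\<close>

lemma LMI_form:
  fixes A\<^sub>p :: "real^'p^'p" and B\<^sub>p :: "real^'u^'p" and C\<^sub>p :: "real^'p^'y"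
    and \<Lambda>\<^sub>p L :: "real^'u^'u"
    and S R :: "real^'p^'p"
    and NA11 :: "real^'p^'p" and NA12 :: "real^'y^'p"
    and NA21 :: "real^'p^'u" and NA22 :: "real^'y^'u"
    and NB :: "real^'f^'p" and NC :: "real^'p^'f"
    and Duw :: "real^'f^'u"
    and hDkvy :: "real^'y^'f" and hDkvw :: "real^'f^'f"
    and \<Lambda>\<^sub>k :: "real^'f^'f"
  assumes S: "symmetric_matrix S"
    and LMI: "neg_semidef
      ((He (A\<^sub>p ** R + B\<^sub>p ** NA21) ||| A\<^sub>p + B\<^sub>p ** NA22 ** C\<^sub>p + transpose NA11 ||| B\<^sub>p
          ||| B\<^sub>p ** Duw + transpose NC ||| \<alpha> *\<^sub>R (transpose NA21 ** transpose L))
   === (NA11 + transpose A\<^sub>p + transpose C\<^sub>p ** transpose NA22 ** transpose B\<^sub>p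
          ||| He (S ** A\<^sub>p + NA12 ** C\<^sub>p) ||| S ** B\<^sub>p
          ||| NB + transpose C\<^sub>p ** transpose hDkvy
          ||| \<alpha> *\<^sub>R (transpose C\<^sub>p ** transpose NA22 ** transpose L))
   === (transpose B\<^sub>p ||| transpose B\<^sub>p ** S ||| - \<Lambda>\<^sub>p ||| 0
          ||| (\<alpha> * (1 + \<sigma>) / 2) *\<^sub>R transpose L)
   === (transpose Duw ** transpose B\<^sub>p + NC ||| transpose NB + hDkvy ** C\<^sub>p ||| 0
          ||| hDkvw + transpose hDkvw - 2 *\<^sub>R \<Lambda>\<^sub>k ||| \<alpha> *\<^sub>R (transpose Duw ** transpose L))
   === (\<alpha> *\<^sub>R (L ** NA21) ||| \<alpha> *\<^sub>R (L ** NA22 ** C\<^sub>p) ||| (\<alpha> * (1 + \<sigma>) / 2) *\<^sub>R L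
          ||| \<alpha> *\<^sub>R (L ** Duw) ||| - mat 1))"
  defines "ut \<equiv> \<lambda>z1 z2 wk. NA21 *v z1 + NA22 *v (C\<^sub>p *v z2) + Duw *v wk"
  shows "2 * (z1 \<bullet> (A\<^sub>p *v (R *v z1 + z2) + B\<^sub>p *v (ut z1 z2 wk + wp)))
     + 2 * (z2 \<bullet> (NA11 *v z1 + S *v (A\<^sub>p *v z2) + NA12 *v (C\<^sub>p *v z2) + S *v (B\<^sub>p *v wp) + NB *v wk))
     - wp \<bullet> (\<Lambda>\<^sub>p *v wp)
     + 2 * (wk \<bullet> (NC *v z1 + hDkvw *v wk + hDkvy *v (C\<^sub>p *v z2) - \<Lambda>\<^sub>k *v wk))
     + (norm (\<alpha> *\<^sub>R (L *v (ut z1 z2 wk + ((1 + \<sigma>) / 2) *\<^sub>R wp))))\<^sup>2 \<le> 0"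
proof -
  define s where "s = \<alpha> *\<^sub>R (L *v (ut z1 z2 wk + ((1 + \<sigma>) / 2) *\<^sub>R wp))"
  \<comment> \<open>Regrouping allows the skew factor to be folded into the opaque constant \<tau>,
    which the simplifier then cannot multiply out.\<close>
  have half: "(\<alpha> * (1 + \<sigma>) / 2) = \<alpha> * ((1 + \<sigma>) / 2)" by simp
  define \<tau> where "\<tau> = (1 + \<sigma>) / 2"
  have "2 * (z1 \<bullet> (A\<^sub>p *v (R *v z1 + z2) + B\<^sub>p *v (ut z1 z2 wk + wp)))
     + 2 * (z2 \<bullet> (NA11 *v z1 + S *v (A\<^sub>p *v z2) + NA12 *v (C\<^sub>p *v z2) + S *v (B\<^sub>p *v wp) + NB *v wk))
     - wp \<bullet> (\<Lambda>\<^sub>p *v wp)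
     + 2 * (wk \<bullet> (NC *v z1 + hDkvw *v wk + hDkvy *v (C\<^sub>p *v z2) - \<Lambda>\<^sub>k *v wk))
     + 2 * (r \<bullet> (\<alpha> *\<^sub>R (L *v (ut z1 z2 wk + \<tau> *\<^sub>R wp)))) - r \<bullet> r \<le> 0" for r
    using LMI[unfolded neg_semidef_def half, folded \<tau>_def, THEN conjunct2, rule_format,
        of "vjoin z1 (vjoin z2 (vjoin wp (vjoin wk r)))"]
    unfolding vcat_mult_vec hcat_mult_vjoin inner_vjoin He_def ut_def
    by (simp add: matrix_vector_mult_add_rdistrib matrix_vector_right_distrib inner_add_left inner_add_right
        matrix_vector_mul_assoc[symmetric] inner_transpose_right inner_transpose_left inner_diff_right
        inner_symmetric_matrix[OF S] matrix_vector_mult_diff_rdistrib algebra_simps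
        matrix_scaleR_vector_ac scaleR_matrix_vector_assoc[symmetric]
        matrix_vector_mult_minus_left del: transpose_matrix_vector)
  from this[of s, unfolded \<tau>_def, folded s_def] show ?thesis
    unfolding s_def[symmetric] power2_norm_eq_inner by linarith
qed

text \<open>The form is squeezed between c |z|^2 and k |z|^2, so a storage value bounded by its
  initial value keeps the state small.\<close>

lemma storage_imp_stabilizes:
  fixes h :: "(real^'p) \<times> (real^'k) \<Rightarrow> (real^'p) \<times> (real^'k) \<Rightarrow> real"
  assumes h: "bounded_bilinear h" and pos: "\<And>z. z \<noteq> 0 \<Longrightarrow> 0 < h z z"
    and decr: "\<And>x T. closed_loop_trajectory P \<phi> K x \<Longrightarrow> 0 < T \<Longrightarrow> h (x T) (x T) \<le> h (x 0) (x 0)"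
  shows "stabilizes K \<phi> P"
  unfolding stabilizes_def
proof (intro allI impI)
  fix \<epsilon> :: real assume \<epsilon>: "0 < \<epsilon>"
  obtain c where c: "0 < c" "\<And>z. c * (norm z)\<^sup>2 \<le> h z z" using pos_bilinear_lower_bound[OF h pos] by blast
  obtain k where k: "0 < k" "\<And>y z. norm (h y z) \<le> norm y * norm z * k"
    using bounded_bilinear.pos_bounded[OF h] by blast
  \<comment> \<open>The factor sqrt (c / k) turns k |x(0)|^2 into less than c \<epsilon>^2. The
    minimum with \<epsilon> settles t = 0, since \<open>decr\<close> speaks of positive times
    only.\<close>
  define \<delta> where "\<delta> = min \<epsilon> (\<epsilon> * sqrt (c / k))"
  have "\<delta> > 0" using \<epsilon> c k by (simp add: \<delta>_def)
  moreover have "norm (x t) < \<epsilon>" if x: "closed_loop_trajectory P \<phi> K x" "norm (x 0) < \<delta>" and t: "0 \<le> t" for x t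
  proof (cases "t = 0")
    case True then show ?thesis using x by (simp add: \<delta>_def)
  next
    case False
    have "c * (norm (x t))\<^sup>2 \<le> h (x t) (x t)" by (rule c)
    also have "\<dots> \<le> h (x 0) (x 0)" using decr[OF x(1)] t False by simp
    also have "\<dots> \<le> k * (norm (x 0))\<^sup>2"
      using k(2)[of "x 0" "x 0"] by (simp add: power2_eq_square algebra_simps)
    also have "\<dots> < k * (\<epsilon> * sqrt (c / k))\<^sup>2"
      using x(2) k(1) by (intro mult_strict_left_mono power_strict_mono) (auto simp: \<delta>_def)
    also have "\<dots> = c * \<epsilon>\<^sup>2" using c k by (simp add: power_mult_distrib)
    finally have "(norm (x t))\<^sup>2 < \<epsilon>\<^sup>2" using c(1) by simp
    then show ?thesis using \<epsilon> by (simp add: power2_less_imp_less)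
  qed
  ultimately show "\<exists>\<delta>>0. \<forall>x. closed_loop_trajectory P \<phi> K x \<and> norm (x 0) < \<delta> \<longrightarrow> (\<forall>t\<ge>0. norm (x t) < \<epsilon>)"
    by blast
qed

text \<open>The sector inequality holds neuron by neuron; a diagonal weight with nonnegative entries
  adds these inequalities without coupling different neurons.\<close>

lemma activation_sector:
  assumes "activation \<phi>" "pos_def \<Lambda>" "diagonal_matrix \<Lambda>"
  shows "0 \<le> \<phi> v \<bullet> (\<Lambda> *v (v - \<phi> v))"
proof -
  have "0 \<le> x \<bullet> (\<Lambda> *v x)" for x
    using assms(2) by (cases "x = 0") (auto simp: pos_def_def less_imp_le)
  then have "pos_semidef \<Lambda>" using assms(2) by (simp add: pos_def_def pos_semidef_def)
  then have \<Lambda>: "0 \<le> \<Lambda> $ i $ i" for i by (rule pos_semidef_diagonal_nonneg)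
  have \<phi>: "0 \<le> \<phi> v $ i * (v - \<phi> v) $ i" for i
    using assms(1) by (auto simp: activation_def)
  show ?thesis
    unfolding inner_diagonal_matrix[OF assms(3)] by (intro sum_nonneg mult_nonneg_nonneg[OF \<Lambda> \<phi>])
qed

section \<open>Invertibility for the reconstruction equations, and the coupling form\<close>

lemma pos_def_left_inverse:
  assumes "pos_def M" obtains M' where "M' ** M = mat 1"
proof -
  have "\<forall>x. M *v x = 0 \<longrightarrow> x = 0" using assms by (force simp: pos_def_def)
  then show thesis using that matrix_left_invertible_ker by metis
qed

lemma coupling_form:
  "vjoin a b \<bullet> (((R ||| mat 1) === (mat 1 ||| S)) *v vjoin c d)
    = a \<bullet> (R *v c) + a \<bullet> d + b \<bullet> c + b \<bullet> (S *v d)"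
  by (simp add: vcat_mult_vec hcat_mult_vjoin inner_vjoin inner_add_right)

lemma vjoin_eq_0_iff: "vjoin a b = 0 \<longleftrightarrow> a = 0 \<and> b = 0"
  using inner_vjoin[of a b a b] by (metis add_nonneg_eq_0_iff inner_eq_zero_iff inner_ge_zero)

lemma coupling_left_inverse:
  fixes R S :: "real^'p^'p"
  assumes "pos_def ((R ||| mat 1) === (mat 1 ||| S))"
  obtains U' where "U' ** (mat 1 - S ** R) = mat 1"
proof -
  have "a = 0" if a: "(mat 1 - S ** R) *v a = 0" for a
  proof (rule ccontr)
    assume "a \<noteq> 0"
    \<comment> \<open>\<open>(a, - R a)\<close> lies in the kernel of the coupling matrix.\<close>
    define b where "b = - (R *v a)"
    have "a + S *v b = 0"
      using a unfolding b_def
      by (simp add: matrix_vector_mult_diff_rdistrib matrix_vector_mul_assoc[symmetric] vec.neg)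
    moreover have "R *v a + b = 0" by (simp add: b_def)
    moreover have "vjoin a b \<bullet> (((R ||| mat 1) === (mat 1 ||| S)) *v vjoin a b)
        = a \<bullet> (R *v a + b) + b \<bullet> (a + S *v b)"
      by (simp add: coupling_form inner_add_right)
    moreover have "vjoin a b \<noteq> 0" using \<open>a \<noteq> 0\<close> by (simp add: vjoin_eq_0_iff)
    ultimately show False using assms by (force simp: pos_def_def)
  qed
  then show thesis using that matrix_left_invertible_ker by metis
qed

text \<open>With \<open>d\<close> and \<open>e\<close> the derivatives of x_k and x_p, the terms in
  \<open>z1\<close> and R d cancel by symmetry of \<open>R\<close>. What remains puts I - SR = U in
  front of \<open>d\<close>, exactly the factor that the reconstruction equations attach to
  \<open>Ak\<close>, \<open>Bkw\<close> and \<open>Bky\<close>.\<close>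

lemma storage_rate:
  fixes R S :: "real^'p^'p"
  assumes R: "symmetric_matrix R" and S: "symmetric_matrix S"
  shows "2 * ((R *v z1 + z2) \<bullet> d + (z1 + S *v z2) \<bullet> (e - R *v d)) =
    2 * (z1 \<bullet> e) + 2 * (z2 \<bullet> (S *v e + (mat 1 - S ** R) *v d))"
  by (simp add: inner_symmetric_matrix[OF R] inner_symmetric_matrix[OF S] inner_add_left inner_add_right
      inner_diff_right matrix_vector_mult_diff_rdistrib matrix_vector_mult_diff_distrib
      matrix_vector_mul_assoc[symmetric] algebra_simps)

theorem mainTheorem2:
  fixes \<alpha> \<sigma> :: real
    and A\<^sub>p :: "real^'p^'p" and B\<^sub>p :: "real^'u^'p" and C\<^sub>p :: "real^'p^'y"
    and \<phi> :: "real^'f \<Rightarrow> real^'f"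
    and \<Lambda>\<^sub>p L :: "real^'u^'u"
    and S R :: "real^'p^'p"
    and NA :: "real^('p + 'y)^('p + 'u)"
    and NA11 :: "real^'p^'p" and NA12 :: "real^'y^'p"
    and NA21 :: "real^'p^'u" and NA22 :: "real^'y^'u"
    and NB :: "real^'f^'p" and NC :: "real^'p^'f"
    and Duw :: "real^'f^'u"
    and hDkvy :: "real^'y^'f" and hDkvw :: "real^'f^'f"
    and \<Lambda>\<^sub>k :: "real^'f^'f"
  assumes alpha: "0 \<le> \<alpha>"
    and act: "activation \<phi>"
    and Lambda_p: "\<Lambda>\<^sub>p = transpose L ** L" "pos_semidef \<Lambda>\<^sub>p" "diagonal_matrix \<Lambda>\<^sub>p"
    and NA_blocks: "NA = ((NA11 ||| NA12) === (NA21 ||| NA22))"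
    and S: "symmetric_matrix S" "pos_def S"
    and R: "symmetric_matrix R" "pos_def R"
    and Lambda_k: "pos_def \<Lambda>\<^sub>k" "diagonal_matrix \<Lambda>\<^sub>k"
    and coupling: "pos_def ((R ||| mat 1) === (mat 1 ||| S))"
    and LMI: "neg_semidef
      ((He (A\<^sub>p ** R + B\<^sub>p ** NA21) ||| A\<^sub>p + B\<^sub>p ** NA22 ** C\<^sub>p + transpose NA11 ||| B\<^sub>p
          ||| B\<^sub>p ** Duw + transpose NC ||| \<alpha> *\<^sub>R (transpose NA21 ** transpose L))
   === (NA11 + transpose A\<^sub>p + transpose C\<^sub>p ** transpose NA22 ** transpose B\<^sub>p
          ||| He (S ** A\<^sub>p + NA12 ** C\<^sub>p) ||| S ** B\<^sub>p
          ||| NB + transpose C\<^sub>p ** transpose hDkvy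
          ||| \<alpha> *\<^sub>R (transpose C\<^sub>p ** transpose NA22 ** transpose L))
   === (transpose B\<^sub>p ||| transpose B\<^sub>p ** S ||| - \<Lambda>\<^sub>p ||| 0
          ||| (\<alpha> * (1 + \<sigma>) / 2) *\<^sub>R transpose L)
   === (transpose Duw ** transpose B\<^sub>p + NC ||| transpose NB + hDkvy ** C\<^sub>p ||| 0
          ||| hDkvw + transpose hDkvw - 2 *\<^sub>R \<Lambda>\<^sub>k ||| \<alpha> *\<^sub>R (transpose Duw ** transpose L))
   === (\<alpha> *\<^sub>R (L ** NA21) ||| \<alpha> *\<^sub>R (L ** NA22 ** C\<^sub>p) ||| (\<alpha> * (1 + \<sigma>) / 2) *\<^sub>R L
          ||| \<alpha> *\<^sub>R (L ** Duw) ||| - mat 1))"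
  shows "\<exists>U V (K :: ('p, 'f, 'u, 'y) nn_controller).
    reconstruction \<lparr>Ap = A\<^sub>p, Bp = B\<^sub>p, Cp = C\<^sub>p\<rparr> S R NA NB NC Duw hDkvy hDkvw \<Lambda>\<^sub>k U V K \<and>
    disk_margin \<alpha> \<sigma> \<lparr>Ap = A\<^sub>p, Bp = B\<^sub>p, Cp = C\<^sub>p\<rparr> \<phi> K"
proof -
  define G where "G = \<lparr>Ap = A\<^sub>p, Bp = B\<^sub>p, Cp = C\<^sub>p\<rparr>"
  define U where "U = mat 1 - S ** R"
  obtain U' where "U' ** U = mat 1" unfolding U_def using coupling_left_inverse[OF coupling] .
  then have "U ** U' = mat 1" by (simp add: matrix_left_right_inverse)
  then have UU: "U ** (U' ** X) = X" for X :: "real^'n^'p" by (simp add: matrix_mul_assoc)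
  obtain \<Lambda>' where "\<Lambda>' ** \<Lambda>\<^sub>k = mat 1" using pos_def_left_inverse[OF Lambda_k(1)] .
  then have "\<Lambda>\<^sub>k ** \<Lambda>' = mat 1" by (simp add: matrix_left_right_inverse)
  then have LL: "\<Lambda>\<^sub>k ** (\<Lambda>' ** X) = X" for X :: "real^'n^'f" by (simp add: matrix_mul_assoc)
  \<comment> \<open>With V = I the lower block row of the N_A equation reads NA21 = Cku + Dkuy C_p R
    and NA22 = Dkuy. Once it is solved, the upper row gives U Bky and then U Ak.\<close>
  define cku where "cku = NA21 - NA22 ** C\<^sub>p ** R"
  define K :: "('p, 'f, 'u, 'y) nn_controller" where "K = \<lparr>
    Ak = U' ** (NA11 - S ** A\<^sub>p ** R - S ** B\<^sub>p ** cku - NA12 ** C\<^sub>p ** R),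
    Bkw = U' ** (NB - S ** B\<^sub>p ** Duw),
    Bky = U' ** (NA12 - S ** B\<^sub>p ** NA22),
    Ckv = \<Lambda>' ** (NC - hDkvy ** C\<^sub>p ** R),
    Dkvw = \<Lambda>' ** hDkvw, Dkvy = \<Lambda>' ** hDkvy,
    Cku = cku, Dkuw = Duw, Dkuy = NA22\<rparr>"
  \<comment> \<open>From here on these parameters of \<open>K\<close> enter only through products
    with \<open>U\<close> and \<open>\<Lambda>\<^sub>k\<close>, so the inverses disappear.\<close>
  have U_parts: "U ** Ak K = NA11 - S ** A\<^sub>p ** R - S ** B\<^sub>p ** cku - NA12 ** C\<^sub>p ** R"
    "U ** Bkw K = NB - S ** B\<^sub>p ** Duw" "U ** Bky K = NA12 - S ** B\<^sub>p ** NA22"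
    by (simp_all add: K_def UU)
  have \<Lambda>_parts: "\<Lambda>\<^sub>k ** Ckv K = NC - hDkvy ** C\<^sub>p ** R" "\<Lambda>\<^sub>k ** Dkvw K = hDkvw" "\<Lambda>\<^sub>k ** Dkvy K = hDkvy"
    by (simp_all add: K_def LL)
  have K_parts: "Cku K = cku" "Dkuw K = Duw" "Dkuy K = NA22" by (simp_all add: K_def)

  have tU: "transpose U = mat 1 - R ** S"
    using R(1) S(1) unfolding U_def
    by (simp add: transpose_diff matrix_transpose_mul symmetric_matrix_def transpose_mat)
  have rec: "reconstruction G S R NA NB NC Duw hDkvy hDkvw \<Lambda>\<^sub>k U (mat 1) K"
    unfolding reconstruction_def NA_blocks
    by (simp add: G_def tU K_parts U_parts \<Lambda>_parts cku_def transpose_mat vcat_mult hcat_mult_vcat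
        mult_hcat hcat_add vcat_add matrix_zero_mult matrix_add_rdistrib matrix_mul_assoc)

  \<comment> \<open>A statement about the values at one instant: \<open>wp\<close> is free, and the
    algebraic loop through \<open>Dkvw\<close> is kept as an equation instead of being solved. The
    uncertainty enters later, through integrals.\<close>
  have diss: "2 * (z1 \<bullet> e) + 2 * (z2 \<bullet> (S *v e + U *v d)) \<le>
      wp \<bullet> (\<Lambda>\<^sub>p *v wp) - \<alpha>\<^sup>2 * (vp \<bullet> (\<Lambda>\<^sub>p *v vp))"
    if e: "e = A\<^sub>p *v xp + B\<^sub>p *v u" and xp: "xp = R *v z1 + z2"
      and y: "y = C\<^sub>p *v xp" and u: "u = vp + ((1 - \<sigma>) / 2) *\<^sub>R wp"
      and vp: "vp = u' + ((1 + \<sigma>) / 2) *\<^sub>R wp"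
      and d: "d = Ak K *v z1 + Bkw K *v wk + Bky K *v y"
      and vk: "vk = Ckv K *v z1 + Dkvw K *v wk + Dkvy K *v y"
      and u': "u' = Cku K *v z1 + Dkuw K *v wk + Dkuy K *v y" and wk: "wk = \<phi> vk"
    for z1 z2 xp e d u u' vp wp vk wk y
  proof -
    \<comment> \<open>The two skew coefficients sum to one, so the plant input is u' + wp for every
      \<sigma>, and the skew survives only in \<open>vp\<close>.\<close>
    have "((1 - \<sigma>) / 2) *\<^sub>R wp + ((1 + \<sigma>) / 2) *\<^sub>R wp = wp"
      by (simp add: scaleR_add_left[symmetric] add_divide_distrib[symmetric])
    then have u2: "u = u' + wp" unfolding u vp by (simp add: add.assoc add.commute)
    have u'2: "u' = NA21 *v z1 + NA22 *v (C\<^sub>p *v z2) + Duw *v wk"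
      unfolding u' y xp K_parts cku_def
      by (simp add: matrix_vector_mult_diff_rdistrib matrix_vector_right_distrib
          matrix_vector_mul_assoc[symmetric])
    have "U *v d = (U ** Ak K) *v z1 + (U ** Bkw K) *v wk + (U ** Bky K) *v y"
      unfolding d by (simp add: matrix_vector_right_distrib matrix_vector_mul_assoc[symmetric])
    then have Sd: "S *v e + U *v d = NA11 *v z1 + S *v (A\<^sub>p *v z2) + NA12 *v (C\<^sub>p *v z2)
        + S *v (B\<^sub>p *v wp) + NB *v wk"
      unfolding U_parts e y xp u2 u'2 cku_def
      by (simp add: matrix_vector_mult_diff_rdistrib matrix_vector_right_distrib
          matrix_vector_mult_diff_distrib matrix_vector_mul_assoc[symmetric])
    have "\<Lambda>\<^sub>k *v vk = (\<Lambda>\<^sub>k ** Ckv K) *v z1 + (\<Lambda>\<^sub>k ** Dkvw K) *v wk + (\<Lambda>\<^sub>k ** Dkvy K) *v y"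
      unfolding vk by (simp add: matrix_vector_right_distrib matrix_vector_mul_assoc[symmetric])
    then have vk2: "\<Lambda>\<^sub>k *v vk = NC *v z1 + hDkvw *v wk + hDkvy *v (C\<^sub>p *v z2)"
      unfolding \<Lambda>_parts y xp
      by (simp add: matrix_vector_mult_diff_rdistrib matrix_vector_right_distrib
          matrix_vector_mul_assoc[symmetric])
    have sector: "0 \<le> wk \<bullet> (\<Lambda>\<^sub>k *v vk - \<Lambda>\<^sub>k *v wk)"
      using activation_sector[OF act Lambda_k, of vk]
      by (simp add: wk matrix_vector_mult_diff_distrib)
    have "(norm (\<alpha> *\<^sub>R (L *v vp)))\<^sup>2 = \<alpha>\<^sup>2 * (vp \<bullet> (\<Lambda>\<^sub>p *v vp))"
      unfolding Lambda_p(1) matrix_vector_mul_assoc[symmetric] inner_transpose_right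
      by (simp add: power_mult_distrib power2_norm_eq_inner)
    \<comment> \<open>By \<open>vk2\<close> the activation term of \<open>LMI_form\<close> is twice
      the expression in \<open>sector\<close>, hence nonnegative, and may be dropped from the
      left-hand side.\<close>
    then show ?thesis
      using LMI_form[OF S(1) LMI, of z1 z2 wk wp, folded u'2, folded xp u2 vp, folded e Sd vk2] sector
      by linarith
  qed

  \<comment> \<open>\<open>J\<close> inverts (z1, z2) |-> (R z1 + z2, z1); being injective, it
    carries definiteness of the coupling matrix over to \<open>h\<close>.\<close>
  define J where "J = (\<lambda>x :: (real^'p) \<times> (real^'p). vjoin (snd x) (fst x - R *v snd x))"
  define h where "h = (\<lambda>x y. J x \<bullet> (((R ||| mat 1) === (mat 1 ||| S)) *v J y))"
  have J: "bounded_linear J" unfolding J_def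
    by (intro bounded_linear_vjoin bounded_linear_snd bounded_linear_sub bounded_linear_fst
        bounded_linear_compose[OF matrix_vector_mul_bounded_linear])
  have h: "bounded_bilinear h" unfolding h_def
    by (intro bounded_bilinear.comp[OF bounded_bilinear_inner] J
        bounded_linear_compose[OF matrix_vector_mul_bounded_linear])
  have h_pos: "0 < h x x" if "x \<noteq> 0" for x
  proof -
    have "J x \<noteq> 0" using that by (auto simp: J_def vjoin_eq_0_iff prod_eq_iff)
    then show ?thesis using coupling by (simp add: h_def pos_def_def)
  qed

  have "stabilizes K \<phi> P" if P: "P \<in> uncertain_plants \<alpha> \<sigma> G" for P
  proof (rule storage_imp_stabilizes[OF h h_pos])
    fix x T assume traj: "closed_loop_trajectory P \<phi> K x" and T: "0 < (T::real)"
    obtain \<Delta> where P_eq: "P = \<lparr>nominal = G, skew = \<sigma>, uncertainty = \<Delta>\<rparr>"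
      and \<Delta>: "\<forall>v\<in>L2e. \<Delta> v \<in> L2e" "diagonal_operator \<Delta>" "L2_gain_less \<Delta> \<alpha>"
      using P unfolding uncertain_plants_def by blast
    obtain vp vk wp wk u u' y where vp: "vp \<in> L2e" and wp: "wp \<in> L2e" and
      eqs: "AE t in lebesgue. 0 \<le> t \<longrightarrow>
       ((\<lambda>s. fst (x s)) has_vector_derivative (A\<^sub>p *v fst (x t) + B\<^sub>p *v u t)) (at t within {0..}) \<and>
       y t = C\<^sub>p *v fst (x t) \<and> u t = vp t + ((1 - \<sigma>) / 2) *\<^sub>R wp t \<and>
       vp t = u' t + ((1 + \<sigma>) / 2) *\<^sub>R wp t \<and> wp t = \<Delta> vp t \<and>
       ((\<lambda>s. snd (x s)) has_vector_derivative (Ak K *v snd (x t) + Bkw K *v wk t + Bky K *v y t))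
         (at t within {0..}) \<and>
       vk t = Ckv K *v snd (x t) + Dkvw K *v wk t + Dkvy K *v y t \<and>
       u' t = Cku K *v snd (x t) + Dkuw K *v wk t + Dkuy K *v y t \<and> wk t = \<phi> (vk t)"
      using traj unfolding closed_loop_trajectory_def P_eq G_def Let_def by auto
    have ac: "abs_continuous_on {0..T} x"
      using traj T by (simp add: closed_loop_trajectory_def abs_continuous_def)
    define g where "g = (\<lambda>t. wp t \<bullet> (\<Lambda>\<^sub>p *v wp t) - \<alpha>\<^sup>2 * (vp t \<bullet> (\<Lambda>\<^sub>p *v vp t)))"
    note int = integrable_diagonal_form[OF _ T Lambda_p(3)]
    show "h (x T) (x T) \<le> h (x 0) (x 0)"
    proof (rule abs_continuous_le_initial_value[OF abs_continuous_on_quadratic[OF h ac] T])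
      show "integrable (lebesgue_on {0..T}) g" unfolding g_def
        by (intro Bochner_Integration.integrable_diff integrable_mult_right int vp wp)
      \<comment> \<open>The gain bound concerns \<Delta> \<open>vp\<close>, which agrees with
        \<open>wp\<close> only almost everywhere; the integrals agree nevertheless.\<close>
      have "AE t in lebesgue. 0 \<le> t \<longrightarrow> wp t = \<Delta> vp t" using eqs by (rule eventually_mono) simp
      then have "AE t in lebesgue_on {0..T}. wp t \<bullet> (\<Lambda>\<^sub>p *v wp t) = \<Delta> vp t \<bullet> (\<Lambda>\<^sub>p *v \<Delta> vp t)"
        by (rule eventually_mono[OF AE_lebesgue_on_nonneg]) simp
      then have "(\<integral>t. wp t \<bullet> (\<Lambda>\<^sub>p *v wp t) \<partial>lebesgue_on {0..T}) =
          (\<integral>t. \<Delta> vp t \<bullet> (\<Lambda>\<^sub>p *v \<Delta> vp t) \<partial>lebesgue_on {0..T})"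
        using \<Delta>(1) vp by (intro integral_cong_AE borel_measurable_integrable int wp) auto
      also have "\<dots> \<le> \<alpha>\<^sup>2 * (\<integral>t. vp t \<bullet> (\<Lambda>\<^sub>p *v vp t) \<partial>lebesgue_on {0..T})"
        by (rule weighted_gain[OF \<Delta> vp T Lambda_p(2,3)])
      finally show "(\<integral>t. g t \<partial>lebesgue_on {0..T}) \<le> 0"
        unfolding g_def
        by (subst Bochner_Integration.integral_diff) (auto intro!: integrable_mult_right int vp wp)
      show "AE t in lebesgue. 0 \<le> t \<longrightarrow>
          (\<exists>d\<le>g t. ((\<lambda>t. h (x t) (x t)) has_vector_derivative d) (at t within {0..}))"
        using eqs
      proof (rule eventually_mono, intro impI)
        fix t :: real
        let ?e = "A\<^sub>p *v fst (x t) + B\<^sub>p *v u t"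
        let ?d = "Ak K *v snd (x t) + Bkw K *v wk t + Bky K *v y t"
        let ?z1 = "\<lambda>t. snd (x t)" and ?z2 = "\<lambda>t. fst (x t) - R *v snd (x t)"
        assume "0 \<le> t" and "0 \<le> t \<longrightarrow>
         ((\<lambda>s. fst (x s)) has_vector_derivative ?e) (at t within {0..}) \<and>
         y t = C\<^sub>p *v fst (x t) \<and> u t = vp t + ((1 - \<sigma>) / 2) *\<^sub>R wp t \<and>
         vp t = u' t + ((1 + \<sigma>) / 2) *\<^sub>R wp t \<and> wp t = \<Delta> vp t \<and>
         ((\<lambda>s. snd (x s)) has_vector_derivative ?d) (at t within {0..}) \<and>
         vk t = Ckv K *v snd (x t) + Dkvw K *v wk t + Dkvy K *v y t \<and>
         u' t = Cku K *v snd (x t) + Dkuw K *v wk t + Dkuy K *v y t \<and> wk t = \<phi> (vk t)"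
        then have d1: "((\<lambda>s. fst (x s)) has_vector_derivative ?e) (at t within {0..})"
          and d2: "(?z1 has_vector_derivative ?d) (at t within {0..})"
          and pt: "y t = C\<^sub>p *v fst (x t)" "u t = vp t + ((1 - \<sigma>) / 2) *\<^sub>R wp t"
            "vp t = u' t + ((1 + \<sigma>) / 2) *\<^sub>R wp t"
            "vk t = Ckv K *v snd (x t) + Dkvw K *v wk t + Dkvy K *v y t"
            "u' t = Cku K *v snd (x t) + Dkuw K *v wk t + Dkuy K *v y t" "wk t = \<phi> (vk t)"
          by blast+
        let ?D = "2 * ((R *v ?z1 t + ?z2 t) \<bullet> ?d + (?z1 t + S *v ?z2 t) \<bullet> (?e - R *v ?d))"
        have hx: "h (x s) (x s) = ?z1 s \<bullet> (R *v ?z1 s) + 2 * (?z1 s \<bullet> ?z2 s) + ?z2 s \<bullet> (S *v ?z2 s)" for s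
          unfolding h_def J_def coupling_form by (simp add: inner_commute)
        have "(?z2 has_vector_derivative (?e - R *v ?d)) (at t within {0..})"
          by (intro has_vector_derivative_diff d1
              bounded_linear.has_vector_derivative[OF matrix_vector_mul_bounded_linear] d2)
        from quadratic_has_vector_derivative[OF R(1) S(1) d2 this]
        have "((\<lambda>t. h (x t) (x t)) has_vector_derivative ?D) (at t within {0..})"
          unfolding hx .
        moreover have "?D \<le> g t"
          unfolding storage_rate[OF R(1) S(1)] g_def U_def[symmetric]
          by (rule diss[OF refl _ pt(1,2,3) refl pt(4,5,6)]) simp
        ultimately show "\<exists>d\<le>g t. ((\<lambda>t. h (x t) (x t)) has_vector_derivative d) (at t within {0..})"
          by blast
      qed
    qed
  qed
  then have "disk_margin \<alpha> \<sigma> G \<phi> K" by (simp add: disk_margin_def)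
  with rec show ?thesis unfolding G_def by blast
qed

end
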